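(* Let $p$ be a prime and let $a\in\mathbb{F}_p((x))$ be a Laurent series that is algebraic over $\mathbb{F}_p(x)$. Assume that the first order differential equation $y'=ay$ is regular at $0$ and has local exponent $\rho=0$. Then there exists a non-zero solution $y\in\mathbb{F}_p[z_1,z_2,\ldots][[x]]$ of $y'=ay$ such that for every $i\ge 1$ the projection $y|_{z_{i+1}=z_{i+2}=\cdots=0}$ is algebraic over $\mathbb{F}_p(x,z_1,\ldots,z_i)$.
   Context: $\mathcal{R}_p=\mathbb{F}_p(z_1,z_2,\ldots)((x))$ is the field of formal Laurent series in $x$ whose coefficients are rational functions over $\mathbb{F}_p$ in countably many variables $z_1,z_2,\ldots$ (each single coefficient involves only finitely many of them). It carries the $\mathbb{F}_p$-derivation $\partial$ (also written $y\mapsto y'$), acting termwise on series in $x$, with $\partial x=1$, $\partial z_1=\frac1x$ and $\partial z_i=\frac{1}{x z_1\cdots z_{i-1}}$ for $i\ge2$. Solutions are understood in $\mathcal{R}_p$, which contains the ring $\mathbb{F}_p[z_1,z_2,\ldots][[x]]$ of power series in $x$ with coefficients polynomials in the $z_i$. The projection $y|_{z_{i+1}=z_{i+2}=\cdots=0}$ of $y\in\mathbb{F}_p[z_1,z_2,\ldots][[x]]$ is obtained by setting $z_j=0$ for all $j>i$ in every coefficient. The equation $y'=ay$ is regular (has a regular singularity) at $0$ if $a$ has a pole of order at most $1$ at $0$; its local exponent is then the coefficient of $x^{-1}$ in $a$. *)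

theory Defs
  imports
    "HOL-Computational_Algebra.Computational_Algebra"
    "HOL-Library.Poly_Mapping"
    "Berlekamp_Zassenhaus.Finite_Field"
begin

unbundle Formal_Laurent_Series.fps_syntax

section \<open>The differential field of Laurent series over rational functions in infinitely many variables\<close>

text \<open>
  Variables are indexed from 0: \<open>zvar j\<close> is the variable \<open>z_(j+1)\<close>.
\<close>

type_synonym 'k zpoly = "(nat \<Rightarrow>\<^sub>0 nat) \<Rightarrow>\<^sub>0 'k"
type_synonym 'k zfrac = "'k zpoly fract"
type_synonym 'k zlaurent = "'k zfrac fls"

abbreviation zconst :: "'k::zero \<Rightarrow> 'k zpoly"
  where "zconst c \<equiv> Poly_Mapping.single 0 c"

definition zvar :: "nat \<Rightarrow> 'k::{zero,one} zpoly"
  where "zvar j = Poly_Mapping.single (Poly_Mapping.single j 1) 1"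

definition zvars :: "'k::zero zpoly \<Rightarrow> nat set"
  where "zvars f = (\<Union>m\<in>Poly_Mapping.keys f. Poly_Mapping.keys m)"

definition zsubst :: "(nat \<Rightarrow> 'k zpoly) \<Rightarrow> 'k::comm_semiring_1 zpoly \<Rightarrow> 'k zpoly"
  where "zsubst s f = (\<Sum>m\<in>Poly_Mapping.keys f. zconst (Poly_Mapping.lookup f m) *
           (\<Prod>j\<in>Poly_Mapping.keys m. s j ^ Poly_Mapping.lookup m j))"


subsection \<open>The derivation\<close>

definition zpderiv :: "nat \<Rightarrow> 'k::comm_semiring_1 zpoly \<Rightarrow> 'k zpoly"
  where "zpderiv j f = (\<Sum>m\<in>Poly_Mapping.keys f.
           Poly_Mapping.single (m - Poly_Mapping.single j 1)
             (of_nat (Poly_Mapping.lookup m j) * Poly_Mapping.lookup f m))"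

text \<open>
  On a series \<open>\<Sum> f_n x^n\<close>, the derivation gives \<open>\<Sum> (\<partial>(f_n) x^n + n f_n x^(n-1))\<close>, and
  all the \<open>\<partial> z_i\<close> lie in \<open>x^(-1) F_p(z)\<close>. So \<open>\<partial> = x^(-1) D\<close> on \<open>F_p(z)\<close>, where \<open>D\<close> is the
  derivation of \<open>F_p(z)\<close> with \<open>D z_i = 1 / (z_1 \<dots> z_(i-1))\<close>. Below, \<open>D\<close> is defined on
  polynomials by the chain rule, on fractions by the quotient rule.
\<close>

definition zvar_deriv :: "nat \<Rightarrow> 'k::field zfrac"
  where "zvar_deriv j = 1 / (\<Prod>k<j. to_fract (zvar k))"

definition zpoly_deriv :: "'k::field zpoly \<Rightarrow> 'k zfrac"
  where "zpoly_deriv f = (\<Sum>j\<in>zvars f. to_fract (zpderiv j f) * zvar_deriv j)"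

definition zfrac_deriv :: "'k::field zfrac \<Rightarrow> 'k zfrac"
  where "zfrac_deriv q = (THE d. \<forall>a b. b \<noteq> 0 \<longrightarrow> q = Fraction_Field.Fract a b \<longrightarrow>
           d = (zpoly_deriv a * to_fract b - to_fract a * zpoly_deriv b) / to_fract b ^ 2)"

text \<open>The maps \<open>h\<close> used with \<open>fls_map\<close> satisfy \<open>h 0 = 0\<close>; otherwise the result is unspecified.\<close>

definition fls_map :: "('a::zero \<Rightarrow> 'b::zero) \<Rightarrow> 'a fls \<Rightarrow> 'b fls"
  where "fls_map h f = Abs_fls (\<lambda>n. h (f $$ n))"

definition fps_map :: "('a \<Rightarrow> 'b) \<Rightarrow> 'a fps \<Rightarrow> 'b fps"
  where "fps_map h f = Abs_fps (\<lambda>n. h (fps_nth f n))"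

definition zlaurent_deriv :: "'k::field zlaurent \<Rightarrow> 'k zlaurent"
  where "zlaurent_deriv f = fls_deriv f + fls_X_inv * fls_map zfrac_deriv f"


subsection \<open>Embeddings and projections\<close>

definition zl_const :: "'k::field \<Rightarrow> 'k zlaurent"
  where "zl_const c = fls_const (to_fract (zconst c))"

definition zl_var :: "nat \<Rightarrow> 'k::field zlaurent"
  where "zl_var j = fls_const (to_fract (zvar j))"

definition zl_of_fls :: "'k::field fls \<Rightarrow> 'k zlaurent"
  where "zl_of_fls = fls_map (\<lambda>c. to_fract (zconst c))"

definition zl_of_fps :: "'k::field zpoly fps \<Rightarrow> 'k zlaurent"
  where "zl_of_fps y = fps_to_fls (fps_map to_fract y)"

text \<open>Setting \<open>z_(i+1) = z_(i+2) = \<dots> = 0\<close>, i.e. keeping \<open>zvar 0, \<dots>, zvar (i-1)\<close>.\<close>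

definition zproj :: "nat \<Rightarrow> 'k::comm_semiring_1 zpoly fps \<Rightarrow> 'k zpoly fps"
  where "zproj i = fps_map (zsubst (\<lambda>j. if j < i then zvar j else 0))"


subsection \<open>Algebraic elements\<close>

text \<open>
  \<open>field_gen S\<close> is the subfield generated by \<open>S\<close>. It contains the prime field, so in
  characteristic \<open>p\<close> it is \<open>F_p(S)\<close>.
\<close>

inductive_set field_gen :: "'a::field set \<Rightarrow> 'a set" for S
  where
    incl: "s \<in> S \<Longrightarrow> s \<in> field_gen S"
  | one: "1 \<in> field_gen S"
  | diff: "a \<in> field_gen S \<Longrightarrow> b \<in> field_gen S \<Longrightarrow> a - b \<in> field_gen S"
  | mult: "a \<in> field_gen S \<Longrightarrow> b \<in> field_gen S \<Longrightarrow> a * b \<in> field_gen S"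
  | inverse: "a \<in> field_gen S \<Longrightarrow> inverse a \<in> field_gen S"

definition algebraic_over :: "'a::field set \<Rightarrow> 'a \<Rightarrow> bool"
  where "algebraic_over K y \<longleftrightarrow> (\<exists>P. P \<noteq> 0 \<and> (\<forall>n. Polynomial.coeff P n \<in> K) \<and> poly P y = 0)"


subsection \<open>First order equations\<close>

definition regular_at_0 :: "'k::field fls \<Rightarrow> bool"
  where "regular_at_0 a \<longleftrightarrow> fls_subdegree a \<ge> -1"

definition local_exponent :: "'k::field fls \<Rightarrow> 'k"
  where "local_exponent a = fls_residue a"


section \<open>The derivation is well defined and has the prescribed values\<close>

lemma zpoly_induct [case_names zero single add]:
  fixes f :: "'k::comm_monoid_add zpoly"
  assumes "P 0" "\<And>m c. P (Poly_Mapping.single m c)" "\<And>f g. P f \<Longrightarrow> P g \<Longrightarrow> P (f + g)"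
  shows "P f"
proof (induction f rule: update_induct)
  case const
  show ?case by (rule assms(1))
next
  case (update f m c)
  have "Poly_Mapping.update m c f = Poly_Mapping.single m c + f"
    using update(1)
    by (intro poly_mapping_eqI) (auto simp: lookup_add lookup_single lookup_update in_keys_iff when_def)
  then show ?case using assms(2,3) update(3) by simp
qed

lemma zpderiv_superset:
  fixes f :: "'k::comm_semiring_1 zpoly"
  assumes "finite A" "Poly_Mapping.keys f \<subseteq> A"
  shows "zpderiv j f = (\<Sum>m\<in>A. Poly_Mapping.single (m - Poly_Mapping.single j 1)
             (of_nat (Poly_Mapping.lookup m j) * Poly_Mapping.lookup f m))"
  unfolding zpderiv_def using assms
  by (intro sum.mono_neutral_left) (auto simp: in_keys_iff)

lemma zpderiv_zero [simp]: "zpderiv j 0 = 0"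
  by (simp add: zpderiv_def)

lemma zpderiv_add: "zpderiv j (f + g) = zpderiv j f + zpderiv j g"
proof -
  let ?A = "Poly_Mapping.keys f \<union> Poly_Mapping.keys g"
  have A: "finite ?A" "Poly_Mapping.keys f \<subseteq> ?A" "Poly_Mapping.keys g \<subseteq> ?A"
    "Poly_Mapping.keys (f + g) \<subseteq> ?A"
    using Poly_Mapping.keys_add[of f g] by auto
  show ?thesis
    unfolding zpderiv_superset[OF A(1,2)] zpderiv_superset[OF A(1,3)] zpderiv_superset[OF A(1,4)]
    by (simp add: lookup_add single_add distrib_left sum.distrib)
qed

lemma zpderiv_single:
  "zpderiv j (Poly_Mapping.single m c) =
     Poly_Mapping.single (m - Poly_Mapping.single j 1) (of_nat (Poly_Mapping.lookup m j) * c)"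
  by (subst zpderiv_superset[of "{m}"]) (auto simp: lookup_single)

lemma zpderiv_mult:
  fixes f g :: "'k::comm_ring_1 zpoly"
  shows "zpderiv j (f * g) = zpderiv j f * g + f * zpderiv j g"
proof (induction f rule: zpoly_induct)
  case zero
  then show ?case by simp
next
  case (add f f')
  then show ?case by (simp add: zpderiv_add algebra_simps)
next
  case f: (single m c)
  show ?case
  proof (induction g rule: zpoly_induct)
    case zero
    then show ?case by simp
  next
    case (add f f')
    then show ?case by (simp add: zpderiv_add algebra_simps)
  next
    case (single n d)
    let ?e = "Poly_Mapping.single j (1::nat)"
    have m: "(m + n) - ?e = (m - ?e) + n" if "Poly_Mapping.lookup m j \<noteq> 0" for m n
      using that by (intro poly_mapping_eqI) (auto simp: lookup_add lookup_minus lookup_single when_def)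
    have 1: "Poly_Mapping.single (m + n - ?e) (of_nat (Poly_Mapping.lookup m j) * c * d)
       = Poly_Mapping.single ((m - ?e) + n) (of_nat (Poly_Mapping.lookup m j) * c * d)"
      using m[of m n] by (cases "Poly_Mapping.lookup m j = 0") simp_all
    have 2: "Poly_Mapping.single (m + n - ?e) (of_nat (Poly_Mapping.lookup n j) * c * d)
       = Poly_Mapping.single (m + (n - ?e)) (of_nat (Poly_Mapping.lookup n j) * c * d)"
      using m[of n m] by (cases "Poly_Mapping.lookup n j = 0") (simp_all add: add.commute)
    show ?case
      using 1 2 by (simp add: zpderiv_single mult_single lookup_add distrib_right distrib_left single_add ac_simps)
  qed
qed

lemma finite_zvars [simp]: "finite (zvars f)"
  by (simp add: zvars_def)

lemma zpoly_deriv_superset: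
  assumes "finite A" "zvars f \<subseteq> A"
  shows "zpoly_deriv f = (\<Sum>j\<in>A. to_fract (zpderiv j f) * zvar_deriv j)"
proof -
  have "zpderiv j f = 0" if "j \<notin> zvars f" for j
    unfolding zpderiv_def using that
    by (intro sum.neutral) (auto simp: zvars_def in_keys_iff)
  then show ?thesis
    unfolding zpoly_deriv_def using assms by (intro sum.mono_neutral_left) auto
qed

lemma zpoly_deriv_superset2:
  fixes f g :: "'k::field zpoly"
  obtains A where "\<And>h. h \<in> {f, g, f + g, f * g} \<Longrightarrow>
    zpoly_deriv h = (\<Sum>j\<in>A. to_fract (zpderiv j h) * zvar_deriv j)"
proof
  fix h assume "h \<in> {f, g, f + g, f * g}"
  then show "zpoly_deriv h = (\<Sum>j\<in>zvars f \<union> zvars g \<union> zvars (f + g) \<union> zvars (f * g).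
      to_fract (zpderiv j h) * zvar_deriv j)"
    by (intro zpoly_deriv_superset) auto
qed

lemma zpoly_deriv_add: "zpoly_deriv (f + g) = zpoly_deriv f + zpoly_deriv g"
  by (rule zpoly_deriv_superset2[of f g]) (simp add: zpderiv_add algebra_simps sum.distrib)

lemma zpoly_deriv_mult:
  "zpoly_deriv (f * g) = zpoly_deriv f * to_fract g + to_fract f * zpoly_deriv g"
  by (rule zpoly_deriv_superset2[of f g])
    (simp add: zpderiv_mult algebra_simps sum.distrib sum_distrib_left sum_distrib_right)

lemma zpoly_deriv_zconst [simp]: "zpoly_deriv (zconst c) = 0"
  by (simp add: zpoly_deriv_def zvars_def)

lemma zpoly_deriv_zvar: "zpoly_deriv (zvar j) = zvar_deriv j"
  by (simp add: zpoly_deriv_def zvars_def zvar_def zpderiv_single)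

lemma Fract_to_fract: "Fraction_Field.Fract a b = to_fract a / to_fract b"
  by (simp add: to_fract_def)

lemma zfrac_deriv_Fract:
  assumes "b \<noteq> 0"
  shows "zfrac_deriv (Fraction_Field.Fract a b) =
    (zpoly_deriv a * to_fract b - to_fract a * zpoly_deriv b) / to_fract b ^ 2"
  unfolding zfrac_deriv_def
proof (rule the_equality)
  show "\<forall>a' b'. b' \<noteq> 0 \<longrightarrow> Fraction_Field.Fract a b = Fraction_Field.Fract a' b' \<longrightarrow>
     (zpoly_deriv a * to_fract b - to_fract a * zpoly_deriv b) / to_fract b ^ 2 =
     (zpoly_deriv a' * to_fract b' - to_fract a' * zpoly_deriv b') / to_fract b' ^ 2"
  proof (intro allI impI)
    fix c d assume d: "d \<noteq> 0" and eq: "Fraction_Field.Fract a b = Fraction_Field.Fract c d"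
    define A B C D where "A = to_fract a" "B = to_fract b" "C = to_fract c" "D = to_fract d"
    define A' B' C' D' where
      "A' = zpoly_deriv a" "B' = zpoly_deriv b" "C' = zpoly_deriv c" "D' = zpoly_deriv d"
    note defs = A_B_C_D_def A'_B'_C'_D'_def
    have nz: "B \<noteq> 0" "D \<noteq> 0" using assms d by (simp_all add: defs)
    have ad: "a * d = c * b" using eq assms d by (simp add: eq_fract)
    have 1: "A * D = C * B"
      using arg_cong[OF ad, of to_fract] by (simp add: defs)
    have 2: "A' * D + A * D' = C' * B + C * B'"
      using arg_cong[OF ad, of zpoly_deriv] by (simp add: defs zpoly_deriv_mult)
    have "(A' * B - A * B') * D^2 = (A' * D) * B * D - (A * D) * B' * D"
      by (simp add: power2_eq_square algebra_simps)
    also have "A' * D = C' * B + C * B' - A * D'" using 2 by (simp add: algebra_simps)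
    also have "(C' * B + C * B' - A * D') * B * D - (A * D) * B' * D =
      C' * B * B * D + C * B' * B * D - (A * D) * D' * B - (A * D) * B' * D"
      by (simp add: algebra_simps)
    also have "\<dots> = (C' * D - C * D') * B^2"
      unfolding 1 by (simp add: power2_eq_square algebra_simps)
    finally have "(A' * B - A * B') / B^2 = (C' * D - C * D') / D^2"
      using nz by (simp add: frac_eq_eq)
    then show "(zpoly_deriv a * to_fract b - to_fract a * zpoly_deriv b) / to_fract b ^ 2 =
      (zpoly_deriv c * to_fract d - to_fract c * zpoly_deriv d) / to_fract d ^ 2"
      by (simp add: defs)
  qed
qed (use assms in blast)

lemma zfrac_deriv_to_fract [simp]: "zfrac_deriv (to_fract f) = zpoly_deriv f"
proof -
  have "zpoly_deriv (1 :: 'a zpoly) = 0"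
    using zpoly_deriv_zconst[of "1::'a"] by simp
  then show ?thesis
    using zfrac_deriv_Fract[of 1 f] by (simp add: to_fract_def flip: One_fract_def)
qed

lemma zfrac_deriv_0 [simp]: "zfrac_deriv 0 = 0"
proof -
  have "zpoly_deriv (0 :: 'a zpoly) = 0"
    using zpoly_deriv_zconst[of "0::'a"] by simp
  then show ?thesis
    using zfrac_deriv_to_fract[of "0::'a zpoly"] by simp
qed

lemma zfrac_deriv_quot:
  assumes "b \<noteq> 0"
  shows "zfrac_deriv (to_fract a / to_fract b) =
    (zpoly_deriv a * to_fract b - to_fract a * zpoly_deriv b) / to_fract b ^ 2"
  using zfrac_deriv_Fract[OF assms, of a] by (simp only: Fract_to_fract)

lemma zfrac_deriv_add: "zfrac_deriv (q + r) = zfrac_deriv q + zfrac_deriv r"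
proof (cases q; cases r)
  fix a b c d :: "'a zpoly"
  assume q: "q = Fraction_Field.Fract a b" "b \<noteq> 0" and r: "r = Fraction_Field.Fract c d" "d \<noteq> 0"
  have nz: "b * d \<noteq> 0" "to_fract b \<noteq> 0" "to_fract d \<noteq> 0" using q r by simp_all
  have qr: "q + r = to_fract (a * d + c * b) / to_fract (b * d)"
    using nz by (simp add: q r Fract_to_fract add_frac_eq del: add_fract)
  show ?thesis
    unfolding qr zfrac_deriv_quot[OF nz(1)]
    unfolding q(1) r(1) zfrac_deriv_Fract[OF q(2)] zfrac_deriv_Fract[OF r(2)]
    using nz(2,3)
    by (simp add: zpoly_deriv_add zpoly_deriv_mult divide_simps power2_eq_square)
      (simp add: algebra_simps)
qed

lemma zfrac_deriv_mult: "zfrac_deriv (q * r) = q * zfrac_deriv r + zfrac_deriv q * r"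
proof (cases q; cases r)
  fix a b c d :: "'a zpoly"
  assume q: "q = Fraction_Field.Fract a b" "b \<noteq> 0" and r: "r = Fraction_Field.Fract c d" "d \<noteq> 0"
  have nz: "b * d \<noteq> 0" "to_fract b \<noteq> 0" "to_fract d \<noteq> 0" using q r by simp_all
  have qr: "q * r = to_fract (a * c) / to_fract (b * d)"
    by (simp add: q r Fract_to_fract del: mult_fract)
  have q': "q = to_fract a / to_fract b" and r': "r = to_fract c / to_fract d"
    by (simp_all only: q r Fract_to_fract)
  show ?thesis
    unfolding qr zfrac_deriv_quot[OF nz(1)]
    unfolding q' r' zfrac_deriv_quot[OF q(2)] zfrac_deriv_quot[OF r(2)]
    using nz(2,3)
    by (simp add: zpoly_deriv_mult divide_simps power2_eq_square) (simp add: algebra_simps)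
qed

lemma fls_map_nth:
  assumes "h 0 = 0"
  shows "fls_map h f $$ n = h (f $$ n)"
  unfolding fls_map_def
  by (rule nth_Abs_fls_lower_bound[of "fls_subdegree f"]) (simp add: assms)

lemma zlaurent_deriv_nth:
  "zlaurent_deriv f $$ n = of_int (n + 1) * f $$ (n + 1) + zfrac_deriv (f $$ (n + 1))"
  by (simp add: zlaurent_deriv_def fls_X_inv_times_conv_shift fls_map_nth)

lemma zlaurent_deriv_add: "zlaurent_deriv (f + g) = zlaurent_deriv f + zlaurent_deriv g"
  by (rule fls_eqI) (simp add: zlaurent_deriv_nth zfrac_deriv_add algebra_simps)

lemma zfrac_deriv_sum: "zfrac_deriv (\<Sum>i\<in>A. h i) = (\<Sum>i\<in>A. zfrac_deriv (h i))"
  by (induction A rule: infinite_finite_induct) (simp_all add: zfrac_deriv_add)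

lemma fls_map_zfrac_deriv_mult:
  "fls_map zfrac_deriv (f * g) = f * fls_map zfrac_deriv g + fls_map zfrac_deriv f * g"
proof (rule fls_eqI)
  fix n
  let ?D = "fls_map zfrac_deriv"
  let ?a = "fls_subdegree f" and ?b = "fls_subdegree g"
  have le: "h \<noteq> 0 \<Longrightarrow> fls_subdegree (?D h) \<ge> fls_subdegree h \<or> ?D h = 0" for h :: "'a zlaurent"
    using fls_subdegree_geI[of "?D h" "fls_subdegree h"] by (auto simp: fls_map_nth)
  have conv: "(f' * g') $$ n = (\<Sum>i=?a..n - ?b. f' $$ i * g' $$ (n - i))"
    if "\<And>i. i < ?a \<Longrightarrow> f' $$ i = 0" "\<And>i. i < ?b \<Longrightarrow> g' $$ i = 0" for f' g' :: "'a zlaurent"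
  proof (cases "f' = 0 \<or> g' = 0")
    case False
    then have "fls_subdegree f' \<ge> ?a" "fls_subdegree g' \<ge> ?b"
      using that by (auto intro: fls_subdegree_geI)
    then show ?thesis
      unfolding fls_times_nth(2)
      by (intro sum.mono_neutral_left) auto
  qed auto
  show "?D (f * g) $$ n = (f * ?D g + ?D f * g) $$ n"
    by (simp add: fls_map_nth conv zfrac_deriv_sum zfrac_deriv_mult sum.distrib)
qed

lemma zlaurent_deriv_mult:
  "zlaurent_deriv (f * g) = f * zlaurent_deriv g + zlaurent_deriv f * g"
  by (simp add: zlaurent_deriv_def fls_map_zfrac_deriv_mult algebra_simps)

lemma zlaurent_deriv_const: "zlaurent_deriv (zl_const c) = 0"
proof (rule fls_eqI)
  show "zlaurent_deriv (zl_const c) $$ n = 0 $$ n" for n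
    by (cases "n = -1") (simp_all add: zlaurent_deriv_nth zl_const_def)
qed

lemma zlaurent_deriv_X: "zlaurent_deriv fls_X = 1"
proof (rule fls_eqI)
  have "zfrac_deriv (1 :: 'a zfrac) = 0"
    using zfrac_deriv_to_fract[of "1 :: 'a zpoly"] zpoly_deriv_zconst[of "1::'a"] by simp
  then show "zlaurent_deriv (fls_X :: 'a zlaurent) $$ n = 1 $$ n" for n
    by (simp add: zlaurent_deriv_nth)
qed

lemma zlaurent_deriv_zl_var: "zlaurent_deriv (zl_var j) = 1 / (fls_X * (\<Prod>k<j. zl_var k))"
proof -
  have prod: "(\<Prod>k<j. zl_var k) = fls_const (\<Prod>k<j. to_fract (zvar k) :: 'a zfrac)" for j
    by (induction j) (simp_all add: zl_var_def fls_const_mult_const)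
  have "zlaurent_deriv (zl_var j) = fls_X_inv * fls_const (zvar_deriv j :: 'a zfrac)"
  proof (rule fls_eqI)
    show "zlaurent_deriv (zl_var j) $$ n = (fls_X_inv * fls_const (zvar_deriv j :: 'a zfrac)) $$ n" for n
      by (cases "n = -1")
        (simp_all add: zlaurent_deriv_nth zl_var_def fls_X_inv_times_conv_shift zpoly_deriv_zvar)
  qed
  also have "\<dots> = 1 / (fls_X * (\<Prod>k<j. zl_var k))"
    unfolding prod zvar_deriv_def
    by (simp add: divide_inverse fls_inverse_const fls_inverse_X)
  finally show ?thesis .
qed


section \<open>Substitution is a ring homomorphism\<close>

lemma zsubst_superset:
  assumes "finite A" "Poly_Mapping.keys f \<subseteq> A"
  shows "zsubst s f = (\<Sum>m\<in>A. zconst (Poly_Mapping.lookup f m) *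
           (\<Prod>j\<in>Poly_Mapping.keys m. s j ^ Poly_Mapping.lookup m j))"
  unfolding zsubst_def using assms
  by (intro sum.mono_neutral_left) (auto simp: in_keys_iff)

lemma zsubst_add: "zsubst s (f + g) = zsubst s f + zsubst s g"
proof -
  let ?A = "Poly_Mapping.keys f \<union> Poly_Mapping.keys g"
  have A: "finite ?A" "Poly_Mapping.keys f \<subseteq> ?A" "Poly_Mapping.keys g \<subseteq> ?A"
    "Poly_Mapping.keys (f + g) \<subseteq> ?A"
    using Poly_Mapping.keys_add[of f g] by auto
  show ?thesis
    unfolding zsubst_superset[OF A(1,2)] zsubst_superset[OF A(1,3)] zsubst_superset[OF A(1,4)]
    by (simp add: lookup_add single_add distrib_right sum.distrib)
qed

lemma zsubst_single:
  "zsubst s (Poly_Mapping.single m c) =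
     zconst c * (\<Prod>j\<in>Poly_Mapping.keys m. s j ^ Poly_Mapping.lookup m j)"
  by (subst zsubst_superset[of "{m}"]) auto

lemma zsubst_zconst: "zsubst s (zconst c) = zconst c"
  by (simp add: zsubst_single)

lemma zsubst_zvar: "zsubst s (zvar j) = s j"
  by (simp add: zvar_def zsubst_single)

lemma zsubst_mult: "zsubst s (f * g) = zsubst s f * zsubst s g"
proof (induction f rule: zpoly_induct)
  case zero
  then show ?case by (simp add: zsubst_def)
next
  case (add f f')
  then show ?case by (simp add: zsubst_add algebra_simps)
next
  case f: (single m c)
  show ?case
  proof (induction g rule: zpoly_induct)
    case zero
    then show ?case by (simp add: zsubst_def)
  next
    case (add f f')
    then show ?case by (simp add: zsubst_add algebra_simps)
  next
    case (single n d)
    let ?A = "Poly_Mapping.keys m \<union> Poly_Mapping.keys n"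
    have ext: "(\<Prod>j\<in>Poly_Mapping.keys k. s j ^ Poly_Mapping.lookup k j) =
        (\<Prod>j\<in>?A. s j ^ Poly_Mapping.lookup k j)" if "Poly_Mapping.keys k \<subseteq> ?A" for k
      using that by (intro prod.mono_neutral_left) (auto simp: in_keys_iff)
    have 1: "Poly_Mapping.keys (m + n) \<subseteq> ?A" "Poly_Mapping.keys m \<subseteq> ?A" "Poly_Mapping.keys n \<subseteq> ?A"
      using Poly_Mapping.keys_add[of m n] by auto
    have 2: "zconst (c * d) = zconst c * zconst d"
      by (simp add: mult_single)
    show ?case
      unfolding zsubst_single mult_single ext[OF 1(1)] ext[OF 1(2)] ext[OF 1(3)]
      by (simp add: 2 lookup_add power_add prod.distrib mult_ac)
  qed
qed

end

theory Submission
  imports Defs "HOL-Algebra.Algebraic_Closure_Type"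
begin

text \<open>
  Let \<open>\<theta> = x \<partial>\<close>, so that \<open>\<theta> z\<^sub>i = 1 / (z\<^sub>1 \<dots> z\<^bsub>i-1\<^esub>)\<close>. The hypotheses on the singularity say that
  \<open>a\<close> is a power series. With \<open>b = x a\<close>, the equation becomes \<open>\<theta> y = b y\<close>.

  Power series in \<open>x\<close> alone solve this up to constants: there are algebraic \<open>h\<^sub>0\<close> and \<open>u\<close> with
  \<open>\<theta> h\<^sub>0 = 0\<close>, \<open>u(0) = 1\<close> and \<open>\<theta> u = (b - h\<^sub>0) u\<close> (\<open>algebraic_solution_modulo_constants\<close>). What remains is
  \<open>\<theta> w = h\<^sub>0 w\<close>. Since \<open>\<theta> z\<^sub>1 = 1\<close>, a solution would be \<open>exp(h\<^sub>0 z\<^sub>1)\<close>, if there were an exponential series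
  in characteristic \<open>p\<close>. Its defining equation \<open>\<theta> w = x w\<close> is again of the type considered, and again
  it can be solved up to a constant: there are algebraic \<open>h\<close> and \<open>e\<close> with \<open>\<theta> h = 0\<close>, \<open>e(0) = 1\<close> and
  \<open>\<theta> e = (x - h) e\<close>. With \<open>t\<^sub>1 = h\<^sub>0 z\<^sub>1\<close>, the factor \<open>e(t\<^sub>1)\<close> leaves the error \<open>h(t\<^sub>1) / z\<^sub>1\<close> in the
  logarithmic derivative. As \<open>h(t\<^sub>1)\<close> is a constant, this error is \<open>\<theta> t\<^sub>2\<close> for \<open>t\<^sub>2 = h(t\<^sub>1) z\<^sub>2\<close>, and the
  procedure can be iterated. With \<open>t\<^bsub>i+1\<^esub> = h(t\<^sub>i) z\<^bsub>i+1\<^esub>\<close>, the logarithmic derivative of \<open>e(t\<^sub>i)\<close> is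
  \<open>\<theta> t\<^sub>i - \<theta> t\<^bsub>i+1\<^esub>\<close> (\<open>deriv_factor\<close>), so that the product \<open>u e(t\<^sub>1) e(t\<^sub>2) \<dots>\<close> is a solution by
  telescoping. It converges because the order of \<open>t\<^sub>i\<close> in \<open>x\<close> tends to infinity. Setting
  \<open>z\<^bsub>i+1\<^esub> = z\<^bsub>i+2\<^esub> = \<dots> = 0\<close> turns all factors after \<open>e(t\<^sub>i)\<close> into 1 (\<open>zproj_solution\<close>). The finite product
  that is left is algebraic, being composed of algebraic series (\<open>algebraic_over_compose\<close>).

  The point is the algebraicity of \<open>h\<^sub>0\<close> and \<open>u\<close>. A power series \<open>g\<close> without constant term is a
  logarithmic derivative \<open>\<theta> u / u\<close> if its coefficients at \<open>n\<close> and \<open>p n\<close> agree for all \<open>n\<close>. Subtracting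
  a series in \<open>x\<^sup>p\<close>, which is a constant, turns \<open>b\<close> into exactly one such series \<open>g = b - h\<^sub>0\<close>, and
  this \<open>g\<close> is algebraic because \<open>g - g\<^sup>p = \<theta>\<^bsup>p-1\<^esup> b\<close>. The operator \<open>\<nabla> = \<theta> - g\<close> then satisfies
  \<open>\<nabla>\<^sup>p = \<nabla>\<close>, so that \<open>u = 1 - \<nabla>\<^bsup>p-1\<^esup> 1\<close> solves \<open>\<nabla> u = 0\<close>. It is algebraic because derivatives of
  algebraic series are algebraic (\<open>algebraic_over_fls_deriv\<close>).
\<close>

(* These names would shadow the operations on polynomials over a type. *)
hide_const (open) Divisibility.prime module.smult up_ring.coeff up_ring.monom
  Polynomials.lead_coeff Polynomials.degree

section \<open>Algebraic elements form a field that is closed under algebraic equations\<close>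

text \<open>
  That the algebraic elements form a field, and that algebraicity is transitive, is known for
  subfields of a ring with an explicit carrier. It is transferred to a field given by a type;
  the translation is between polynomials and lists of coefficients, leading coefficient first.
\<close>

abbreviation type_ring :: "'a::field ring"
  where "type_ring \<equiv> ring_of_type_algebra"

lemma type_ring_simps [simp]:
  "carrier type_ring = UNIV" "mult type_ring = (*)" "one type_ring = 1"
  "zero type_ring = 0" "add type_ring = (+)"
  by (simp_all add: ring_of_type_algebra_def fun_eq_iff)

lemma field_type_ring: "Ring.field (type_ring :: 'a::field ring)"
  by (rule field_from_type_algebra)

lemma type_ring_uminus [simp]: "a_inv type_ring x = - (x :: 'a::field)"
proof -
  interpret Ring.field "type_ring :: 'a ring" by (rule field_type_ring)
  have "x \<oplus>\<^bsub>type_ring\<^esub> (- x) = \<zero>\<^bsub>type_ring\<^esub>" by simp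
  then show ?thesis using minus_equality[of "- x" x] by simp
qed

lemma type_ring_inverse: "x \<noteq> 0 \<Longrightarrow> m_inv type_ring x = inverse (x :: 'a::field)"
proof -
  interpret Ring.field "type_ring :: 'a ring" by (rule field_type_ring)
  assume "x \<noteq> 0"
  then show ?thesis by (intro comm_inv_char) simp_all
qed

lemma type_ring_power [simp]: "x [^]\<^bsub>type_ring\<^esub> (n::nat) = (x :: 'a::field) ^ n"
proof -
  interpret Ring.field "type_ring :: 'a ring" by (rule field_type_ring)
  show ?thesis by (induction n) (simp_all add: mult.commute)
qed

lemma eval_type_ring: "ring.eval type_ring p x = poly (Poly (rev p)) (x :: 'a::field)"
proof -
  interpret Ring.field "type_ring :: 'a ring" by (rule field_type_ring)
  show ?thesis
    by (induction p) (simp_all add: Poly_append poly_monom)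
qed

lemma algebraic_over_iff_HOL_Algebra:
  assumes "subfield K (type_ring :: 'a::field ring)"
  shows "algebraic_over K x \<longleftrightarrow> ring.algebraic type_ring K x"
proof
  interpret Ring.field "type_ring :: 'a ring" by (rule field_type_ring)
  have K: "0 \<in> K" using subringE(2)[OF subfieldE(1)[OF assms]] by simp
  show "algebraic_over K x" if "ring.algebraic type_ring K x"
  proof -
    have "(algebraic over K) x" using that unfolding over_def .
    then obtain p where p: "p \<in> carrier (K [X]\<^bsub>type_ring\<^esub>)" "p \<noteq> []" "eval p x = 0"
      by (rule algebraicE[OF subfieldE(1)[OF assms], rotated]) simp_all
    then have set: "set p \<subseteq> K" and lead: "hd p \<noteq> 0"
      by (auto simp: polynomial_def simp flip: univ_poly_carrier)
    have "Polynomial.coeff (Poly (rev p)) (length p - 1) = hd p"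
      using p(2) by (cases p) (simp_all add: nth_default_append)
    with lead have "Poly (rev p) \<noteq> 0" by (metis Polynomial.coeff_0)
    moreover have "Polynomial.coeff (Poly (rev p)) n \<in> K" for n
      using set K nth_mem[of n "rev p"] by (auto simp: nth_default_def)
    ultimately show ?thesis
      using p(3) unfolding algebraic_over_def eval_type_ring by blast
  qed
  show "ring.algebraic type_ring K x" if "algebraic_over K x"
  proof -
    obtain P where P: "P \<noteq> 0" "\<And>n. Polynomial.coeff P n \<in> K" "poly P x = 0"
      using \<open>algebraic_over K x\<close> by (auto simp: algebraic_over_def)
    define p where "p = rev (coeffs P)"
    have "set p \<subseteq> K" using P(2) by (auto simp: p_def coeffs_def)
    moreover have "p \<noteq> []" "hd p \<noteq> 0"
      using P(1) by (simp_all add: p_def hd_rev last_coeffs_eq_coeff_degree)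
    moreover have "eval p x = 0"
      using P(3) by (simp add: eval_type_ring p_def)
    ultimately show ?thesis
      using algebraicI[of p K x] by (simp add: over_def polynomial_def flip: univ_poly_carrier)
  qed
qed

lemma field_gen_zero: "0 \<in> field_gen S"
  using field_gen.diff[OF field_gen.one field_gen.one] by simp

lemma field_gen_uminus: "a \<in> field_gen S \<Longrightarrow> - a \<in> field_gen S"
  using field_gen.diff[OF field_gen_zero, of a] by simp

lemma field_gen_add: "a \<in> field_gen S \<Longrightarrow> b \<in> field_gen S \<Longrightarrow> a + b \<in> field_gen S"
  using field_gen.diff[OF _ field_gen_uminus, of a S b] by simp

lemma subfield_field_gen: "subfield (field_gen S) (type_ring :: 'a::field ring)"
proof -
  interpret Ring.field "type_ring :: 'a ring" by (rule field_type_ring)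
  show ?thesis
    by (intro subfieldI' subringI)
      (auto simp: type_ring_inverse intro: field_gen.intros field_gen_uminus field_gen_add)
qed

lemma subfield_algebraic_over:
  assumes "subfield K (type_ring :: 'a::field ring)"
  shows "subfield {x. algebraic_over K x} (type_ring :: 'a::field ring)"
proof -
  interpret Ring.field "type_ring :: 'a ring" by (rule field_type_ring)
  show ?thesis
    using subfield_of_algebraics[OF assms]
    by (simp add: algebraic_over_iff_HOL_Algebra[OF assms] over_def)
qed

text \<open>
  The coefficients generate a finite extension \<open>F\<close> of \<open>K\<close>, and \<open>F(y)\<close> is finite over \<open>F\<close>, hence
  over \<open>K\<close>.
\<close>

lemma algebraic_over_trans:
  assumes K: "subfield K (type_ring :: 'a::field ring)"
    and P: "P \<noteq> 0" "\<And>n. algebraic_over K (Polynomial.coeff P n)" "poly P y = 0"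
  shows "algebraic_over K (y :: 'a)"
proof -
  interpret Ring.field "type_ring :: 'a ring" by (rule field_type_ring)
  note alg = algebraic_over_iff_HOL_Algebra[OF K]
  define F where "F = finite_extension K (coeffs P)"
  have set: "set (coeffs P) \<subseteq> carrier (type_ring :: 'a ring)" by simp
  have algs: "(algebraic over K) x" if "x \<in> set (coeffs P)" for x
  proof -
    obtain n where "x = Polynomial.coeff P n"
      using \<open>x \<in> set (coeffs P)\<close> range_coeff[of P] by blast
    with P(2)[of n] show ?thesis unfolding alg over_def by simp
  qed
  have F: "subfield F type_ring"
    unfolding F_def using finite_extension_is_subfield[OF K set algs] .
  have KF: "finite_dimension K F"
    unfolding F_def by (intro finite_extension_finite_dimension(1)[OF K set algs])
  have "set (coeffs P) \<subseteq> F"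
    unfolding F_def by (rule finite_extension_mem[OF subfieldE(1)[OF K] set])
  then have "Polynomial.coeff P n \<in> F" for n
    using subringE(2)[OF subfieldE(1)[OF F]] range_coeff[of P] rangeI[of "Polynomial.coeff P" n] by auto
  then have "algebraic_over F y"
    unfolding algebraic_over_def using P by blast
  then have "(algebraic over F) y"
    unfolding algebraic_over_iff_HOL_Algebra[OF F] over_def .
  then have "finite_dimension F (simple_extension F y)"
    using finite_dimension_simple_extension[OF F, of y] by simp
  then have "finite_dimension K (simple_extension F y)"
    by (rule telescopic_base_dim(1)[OF K F KF])
  then have "(algebraic over K) y"
    using finite_dimension_imp_algebraic[OF K simple_extension_is_subring[OF subfieldE(1)[OF F]]]
      simple_extension_mem[OF subfieldE(1)[OF F]] by simp
  then show ?thesis by (simp add: alg over_def)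
qed

lemma algebraic_over_self: "x \<in> field_gen S \<Longrightarrow> algebraic_over (field_gen S) x"
  unfolding algebraic_over_def
  by (intro exI[of _ "[:-x, 1:]"])
    (auto simp: coeff_pCons field_gen_uminus field_gen.one field_gen_zero split: nat.split)

lemma algebraic_over_field_ops:
  assumes "algebraic_over (field_gen S) x" "algebraic_over (field_gen S) y"
  shows "algebraic_over (field_gen S) (x + y)" "algebraic_over (field_gen S) (x * y)"
    "algebraic_over (field_gen S) (- x)" "algebraic_over (field_gen S) (inverse x)"
proof -
  interpret Ring.field "type_ring :: 'a ring" by (rule field_type_ring)
  have A: "subfield {x. algebraic_over (field_gen S) x} (type_ring :: 'a ring)"
    by (rule subfield_algebraic_over[OF subfield_field_gen])
  note R = subringE[OF subfieldE(1)[OF A]]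
  show "algebraic_over (field_gen S) (x + y)" "algebraic_over (field_gen S) (x * y)"
    "algebraic_over (field_gen S) (- x)"
    using R(5)[of x] R(6,7)[of x y] assms by simp_all
  show "algebraic_over (field_gen S) (inverse x)"
    using subfield_m_inv(1)[OF A, of x] assms
    by (cases "x = 0") (simp_all add: type_ring_inverse)
qed

lemma algebraic_over_diff:
  "algebraic_over (field_gen S) x \<Longrightarrow> algebraic_over (field_gen S) y \<Longrightarrow>
    algebraic_over (field_gen S) (x - y)"
  using algebraic_over_field_ops(1)[of S x "- y"] algebraic_over_field_ops(3)[of S y y] by simp

section \<open>The Frobenius map\<close>

lemma mod_ring_power_card [simp]: "(c :: 'p::prime_card mod_ring) ^ CARD('p) = c"
  by (metis CARD_mod_ring finite_field_power_card_eq_same)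

lemma power_card_sum:
  fixes f :: "'i \<Rightarrow> 'p::prime_card mod_ring fls"
  shows "sum f A ^ CARD('p) = (\<Sum>i\<in>A. f i ^ CARD('p))"
  by (rule freshmans_dream_sum) (simp_all add: prime_card)

text \<open>
  The Frobenius map fixes the coefficients, so \<open>f\<^sup>p = f(x\<^sup>p)\<close>. Only finitely many coefficients of \<open>f\<close>
  matter for a given coefficient of \<open>f\<^sup>p\<close>, so that additivity of the \<open>p\<close>-th power for finite sums
  suffices.
\<close>

lemma fps_power_card_nth:
  fixes f :: "'p::prime_card mod_ring fps"
  shows "(f ^ CARD('p)) $ n = (if CARD('p) dvd n then f $ (n div CARD('p)) else 0)"
proof -
  let ?p = "CARD('p)"
  have p: "prime ?p" by (rule prime_card)
  define N where "N = Suc n"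
  have lt: "n < N * ?p"
    using prime_gt_0_nat[OF p] by (cases ?p) (auto simp: N_def)
  let ?g = "\<Sum>i<N. fps_const (f $ i) * fps_X ^ i" and ?h = "fps_X ^ N * fps_shift N f"
  have g: "?g $ m = (if m < N then f $ m else 0)" for m
  proof -
    have "?g $ m = (\<Sum>i<N. if i = m then f $ i else 0)"
      unfolding fps_sum_nth by (intro sum.cong) (auto simp: fps_X_power_nth)
    then show ?thesis by simp
  qed
  have "f = ?g + ?h"
    by (rule fps_ext) (simp only: fps_add_nth g, simp add: fps_X_power_mult_nth)
  then have "f ^ ?p = (?g + ?h) ^ ?p" by simp
  also have "\<dots> = ?g ^ ?p + ?h ^ ?p"
    by (rule freshmans_dream) (use p in simp_all)
  also have "?g ^ ?p = (\<Sum>i<N. (fps_const (f $ i) * fps_X ^ i) ^ ?p)"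
    by (rule freshmans_dream_sum) (use p in simp_all)
  also have "\<dots> = (\<Sum>i<N. fps_const (f $ i) * fps_X ^ (i * ?p))"
    by (simp add: power_mult_distrib fps_const_power power_mult)
  also have "?h ^ ?p = fps_X ^ (N * ?p) * fps_shift N f ^ ?p"
    by (simp only: power_mult_distrib power_mult)
  finally have "(f ^ ?p) $ n = (\<Sum>i<N. (fps_const (f $ i) * fps_X ^ (i * ?p)) $ n) +
      (fps_X ^ (N * ?p) * fps_shift N f ^ ?p) $ n"
    by (simp only: fps_add_nth fps_sum_nth)
  also have "(fps_X ^ (N * ?p) * fps_shift N f ^ ?p) $ n = 0"
    using lt by (simp add: fps_X_power_mult_nth)
  also have "(\<Sum>i<N. (fps_const (f $ i) * fps_X ^ (i * ?p)) $ n) =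
      (\<Sum>i<N. if i = n div ?p then (if ?p dvd n then f $ i else 0) else 0)"
    using prime_gt_0_nat[OF p] by (intro sum.cong) (auto simp: fps_X_power_nth)
  also have "\<dots> = (if n div ?p < N then if ?p dvd n then f $ (n div ?p) else 0 else 0)"
    by simp
  finally show ?thesis
    using le_less_trans[OF div_le_dividend, of n N ?p] by (simp add: N_def)
qed

section \<open>Algebraic Laurent series\<close>

text \<open>
  An algebraic Laurent series is a root of a polynomial over \<open>F\<^sub>p[x]\<close>. Clearing denominators in this
  way makes it possible to differentiate the equation with respect to \<open>x\<close>, and to substitute another
  series for \<open>x\<close>.
\<close>

definition fls_of_poly :: "'k::field poly \<Rightarrow> 'k fls"
  where "fls_of_poly q = fps_to_fls (fps_of_poly q)"

lemma fls_of_poly_simps [simp]: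
  "fls_of_poly 0 = 0" "fls_of_poly 1 = 1"
  "fls_of_poly (q + r) = fls_of_poly q + fls_of_poly r"
  "fls_of_poly (q - r) = fls_of_poly q - fls_of_poly r"
  "fls_of_poly (q * r) = fls_of_poly q * fls_of_poly r"
  "fls_of_poly (pCons c q) = fls_const c + fls_X * fls_of_poly q"
  "fls_deriv (fls_of_poly q) = fls_of_poly (pderiv q)"
  by (simp_all add: fls_of_poly_def fps_of_poly_add fps_of_poly_diff fps_of_poly_mult
      fls_times_fps_to_fls fps_of_poly_pCons fls_deriv_fps_to_fls fps_of_poly_pderiv mult.commute)

lemma fls_of_poly_eq_0_iff [simp]: "fls_of_poly q = 0 \<longleftrightarrow> q = 0"
  unfolding fls_of_poly_def fps_to_fls_eq_0_iff by (metis fps_of_poly_0 fps_of_poly_eq_iff)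

definition poly_fls :: "'k::field poly poly \<Rightarrow> 'k fls \<Rightarrow> 'k fls"
  where "poly_fls P w = poly (map_poly fls_of_poly P) w"

lemma poly_fls_simps [simp]:
  "poly_fls 0 w = 0" "poly_fls (pCons q P) w = fls_of_poly q + w * poly_fls P w"
  by (simp_all add: poly_fls_def Polynomial.map_poly_pCons)

lemma poly_fls_add [simp]: "poly_fls (P + Q) w = poly_fls P w + poly_fls Q w"
  by (induction P Q rule: poly_induct2) (simp_all add: algebra_simps)

lemma poly_fls_altdef:
  assumes "Polynomial.degree P \<le> n"
  shows "poly_fls P w = (\<Sum>i\<le>n. fls_of_poly (coeff P i) * w ^ i)"
proof -
  have "degree (map_poly fls_of_poly P) \<le> n"
    using assms degree_map_poly_le[of fls_of_poly P] by linarith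
  then have "poly_fls P w = (\<Sum>i\<le>n. coeff (map_poly fls_of_poly P) i * w ^ i)"
    unfolding poly_fls_def poly_altdef
    by (intro sum.mono_neutral_left) (auto simp: coeff_eq_0)
  then show ?thesis by (simp add: coeff_map_poly)
qed

lemma field_gen_X_fraction:
  assumes "(q :: 'k::field fls) \<in> field_gen {fls_X}"
  obtains n d where "d \<noteq> 0" "q * fls_of_poly d = fls_of_poly n"
proof -
  have "\<exists>n d. d \<noteq> 0 \<and> q * fls_of_poly d = fls_of_poly n"
    using assms
  proof induction
    case (incl s)
    then show ?case by (intro exI[of _ "[:0, 1:]"] exI[of _ 1]) simp
  next
    case one
    show ?case by (intro exI[of _ 1]) simp
  next
    case (diff a b)
    then obtain n d n' d' where *: "d \<noteq> 0" "a * fls_of_poly d = fls_of_poly n"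
      "d' \<noteq> 0" "b * fls_of_poly d' = fls_of_poly n'" by blast
    have "(a - b) * fls_of_poly (d * d') = fls_of_poly (n * d' - n' * d)"
      by (simp add: algebra_simps flip: *(2,4))
    then show ?case using * by (metis mult_eq_0_iff)
  next
    case (mult a b)
    then obtain n d n' d' where *: "d \<noteq> 0" "a * fls_of_poly d = fls_of_poly n"
      "d' \<noteq> 0" "b * fls_of_poly d' = fls_of_poly n'" by blast
    have "(a * b) * fls_of_poly (d * d') = fls_of_poly (n * n')"
      by (simp add: algebra_simps flip: *(2,4))
    then show ?case using * by (metis mult_eq_0_iff)
  next
    case (inverse a)
    then obtain n d where *: "d \<noteq> 0" "a * fls_of_poly d = fls_of_poly n" by blast
    show ?case
    proof (cases "a = 0")
      case True
      then show ?thesis by (intro exI[of _ 0] exI[of _ 1]) simp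
    next
      case False
      then have "inverse a * fls_of_poly n = fls_of_poly d"
        by (simp flip: *(2) mult.assoc)
      moreover have "n \<noteq> 0"
        using False * by (metis fls_of_poly_eq_0_iff mult_eq_0_iff)
      ultimately show ?thesis by blast
    qed
  qed
  then show ?thesis using that by blast
qed

lemma clear_denominators:
  fixes P :: "'k::field fls poly"
  assumes "\<And>i. coeff P i \<in> field_gen {fls_X}"
  obtains d Q where "d \<noteq> 0" "map_poly fls_of_poly Q = smult (fls_of_poly d) P"
proof -
  have "\<exists>d Q. d \<noteq> 0 \<and> map_poly fls_of_poly Q = smult (fls_of_poly d) P"
    using assms
  proof (induction P)
    case 0
    show ?case by (intro exI[of _ 0] exI[of _ 1]) simp
  next
    case (pCons c P)
    have "coeff P i \<in> field_gen {fls_X}" for i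
      using pCons.prems[of "Suc i"] by simp
    then obtain d Q where Q: "d \<noteq> 0" "map_poly fls_of_poly Q = smult (fls_of_poly d) P"
      using pCons.IH by blast
    have "c \<in> field_gen {fls_X}" using pCons.prems[of 0] by simp
    then obtain n e where c: "e \<noteq> 0" "c * fls_of_poly e = fls_of_poly n"
      by (rule field_gen_X_fraction)
    have "map_poly fls_of_poly (pCons (d * n) (smult e Q)) = smult (fls_of_poly (d * e)) (pCons c P)"
      using Q(2) by (simp add: Polynomial.map_poly_pCons map_poly_smult mult_ac flip: c(2))
    then show ?case using Q(1) c(1) by (metis mult_eq_0_iff)
  qed
  then show ?thesis using that by blast
qed

lemma algebraic_over_X_equation:
  assumes "algebraic_over (field_gen {fls_X}) w"
  obtains P where "P \<noteq> 0" "poly_fls P w = 0"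
proof -
  obtain P where P: "P \<noteq> 0" "\<And>n. coeff P n \<in> field_gen {fls_X}" "poly P w = 0"
    using assms by (auto simp: algebraic_over_def)
  obtain d Q where Q: "d \<noteq> 0" "map_poly fls_of_poly Q = smult (fls_of_poly d) P"
    using clear_denominators P(2) by blast
  show ?thesis
  proof
    show "poly_fls Q w = 0" using P(3) by (simp add: poly_fls_def Q(2))
    show "Q \<noteq> 0" using P(1) Q by auto
  qed
qed

lemma of_nat_field_gen: "of_nat n \<in> field_gen S"
  by (induction n) (auto intro: field_gen_zero field_gen_add field_gen.one)

lemma fls_of_poly_field_gen:
  fixes q :: "'p::prime_card mod_ring poly"
  shows "fls_of_poly q \<in> field_gen {fls_X}"
proof (induction q)
  case (pCons c q)
  obtain n where "c = of_nat n" using surj_of_nat_mod_ring by blast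
  then have "fls_const c \<in> field_gen {fls_X}"
    by (simp add: of_nat_field_gen flip: fls_of_nat)
  then show ?case
    using pCons.IH by (auto intro!: field_gen_add field_gen.mult intro: field_gen.incl)
qed (simp add: field_gen_zero)

lemma algebraic_over_poly_fls:
  fixes w :: "'p::prime_card mod_ring fls"
  assumes "algebraic_over (field_gen {fls_X}) w"
  shows "algebraic_over (field_gen {fls_X}) (poly_fls P w)"
  by (induction P)
    (simp_all add: assms algebraic_over_self field_gen_zero fls_of_poly_field_gen algebraic_over_field_ops)

lemma fls_deriv_poly_fls:
  "fls_deriv (poly_fls P w) = poly_fls (map_poly pderiv P) w + poly_fls (pderiv P) w * fls_deriv w"
  by (induction P) (simp_all add: Polynomial.map_poly_pCons pderiv_pCons algebra_simps)

section \<open>Derivatives of algebraic series are algebraic\<close>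

text \<open>
  A polynomial whose derivative vanishes is a polynomial in \<open>x\<^sup>p\<close>; if \<open>r\<close> takes \<open>p\<close>-th roots of its
  coefficients, this is its \<open>p\<close>-th root. The root map is a parameter so that the construction can be
  nested: the root of a polynomial in two variables takes roots of the coefficient polynomials.
\<close>

definition frobenius_root :: "('k \<Rightarrow> 'k) \<Rightarrow> nat \<Rightarrow> 'k::zero poly \<Rightarrow> 'k poly"
  where "frobenius_root r p q = Poly (map (\<lambda>i. r (coeff q (p * i))) [0..<Suc (degree q)])"

lemma coeff_frobenius_root:
  assumes "p > 0" "r 0 = 0"
  shows "coeff (frobenius_root r p q) i = r (coeff q (p * i))"
proof -
  have "r (coeff q (p * i)) = 0" if "\<not> i \<le> degree q"
  proof -
    have "degree q < p * i" using assms that by (cases p) auto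
    then show ?thesis using assms(2) by (simp add: coeff_eq_0)
  qed
  then show ?thesis
    by (auto simp: frobenius_root_def nth_default_def simp del: upt_Suc)
qed

lemma pderiv_eq_0_coeff:
  fixes q :: "'a::{idom,semiring_prime_char} poly"
  assumes "pderiv q = 0" "\<not> CHAR('a) dvd i"
  shows "coeff q i = 0"
proof (cases i)
  case 0
  then show ?thesis using assms(2) by simp
next
  case (Suc j)
  have "of_nat i * coeff q i = 0"
    using assms(1) coeff_pderiv[of q j] by (simp add: Suc)
  then show ?thesis using assms(2) by (simp add: of_nat_eq_0_iff_char_dvd)
qed

lemma fls_of_poly_frobenius_root:
  fixes q :: "'p::prime_card mod_ring poly"
  assumes "pderiv q = 0"
  shows "fls_of_poly (frobenius_root id CARD('p) q) ^ CARD('p) = fls_of_poly q"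
proof -
  have p: "CARD('p) > 0" using prime_gt_0_nat[OF prime_card[where 'a='p]] .
  have "fps_of_poly (frobenius_root id CARD('p) q) ^ CARD('p) = fps_of_poly q"
    using p pderiv_eq_0_coeff[OF assms]
    by (intro fps_ext) (auto simp: fps_power_card_nth coeff_frobenius_root)
  then show ?thesis
    by (simp add: fls_of_poly_def flip: fps_to_fls_power)
qed

lemma poly_fls_frobenius_root:
  fixes P :: "'p::prime_card mod_ring poly poly"
  assumes "pderiv P = 0" "map_poly pderiv P = 0"
  defines "R \<equiv> frobenius_root (frobenius_root id CARD('p)) CARD('p) P"
  shows "poly_fls R w ^ CARD('p) = poly_fls P w"
    and "CARD('p) * degree R \<le> degree P"
    and "P \<noteq> 0 \<Longrightarrow> R \<noteq> 0"
proof -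
  let ?p = "CARD('p)"
  have p: "?p > 0" using prime_gt_0_nat[OF prime_card[where 'a='p]] .
  have char: "CHAR('p mod_ring poly) = ?p" by simp
  have root0: "frobenius_root id ?p 0 = (0 :: 'p mod_ring poly)"
    by (rule poly_eqI) (simp add: coeff_frobenius_root p)
  have coeff_R: "coeff R i = frobenius_root id ?p (coeff P (?p * i))" for i
    unfolding R_def by (rule coeff_frobenius_root) (simp_all add: p root0)
  have pd: "pderiv (coeff P i) = 0" for i
    using arg_cong[OF assms(2), of "\<lambda>Q. coeff Q i"] by (simp add: coeff_map_poly)
  have pow: "fls_of_poly (coeff R i) ^ ?p = fls_of_poly (coeff P (?p * i))" for i
    unfolding coeff_R by (rule fls_of_poly_frobenius_root[OF pd])
  have nz: "coeff R i \<noteq> 0 \<longleftrightarrow> coeff P (?p * i) \<noteq> 0" for i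
    using pow[of i] p by (metis fls_of_poly_eq_0_iff power_eq_0_iff)
  have P0: "coeff P i = 0" if "\<not> ?p dvd i" for i
    using pderiv_eq_0_coeff[OF assms(1), of i] that by simp
  show R0: "R \<noteq> 0" if "P \<noteq> 0"
  proof -
    have "coeff P (degree P) \<noteq> 0" using that by simp
    with P0 obtain j where "degree P = ?p * j" by (metis dvd_def)
    then have "coeff R j \<noteq> 0" using nz[of j] \<open>coeff P (degree P) \<noteq> 0\<close> by simp
    then show ?thesis by auto
  qed
  show deg: "?p * degree R \<le> degree P"
  proof (cases "P = 0")
    case False
    have "coeff R (degree R) \<noteq> 0" using R0[OF False] by simp
    then show ?thesis using nz le_degree by blast
  qed (simp add: R_def frobenius_root_def root0)
  have "poly_fls R w = (\<Sum>i\<le>degree R. fls_of_poly (coeff R i) * w ^ i)"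
    by (rule poly_fls_altdef) simp
  then have "poly_fls R w ^ ?p = (\<Sum>i\<le>degree R. fls_of_poly (coeff P (?p * i)) * w ^ (?p * i))"
    by (simp add: power_card_sum power_mult_distrib pow mult.commute flip: power_mult)
  also have "\<dots> = (\<Sum>i\<in>(*) ?p ` {..degree R}. fls_of_poly (coeff P i) * w ^ i)"
    using p by (subst sum.reindex) (auto simp: inj_on_def)
  also have "\<dots> = (\<Sum>i\<le>degree P. fls_of_poly (coeff P i) * w ^ i)"
  proof (rule sum.mono_neutral_left)
    show "(*) ?p ` {..degree R} \<subseteq> {..degree P}"
      using deg p by (auto intro: order_trans[OF mult_le_mono2])
    have "coeff P i = 0" if "i \<notin> (*) ?p ` {..degree R}" for i
    proof (cases "?p dvd i")
      case True
      then obtain j where j: "i = ?p * j" by blast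
      with that have "degree R < j" by (metis atMost_iff image_eqI not_le)
      then show ?thesis using nz[of j] j coeff_eq_0 by blast
    qed (rule P0)
    then show "\<forall>i\<in>{..degree P} - (*) ?p ` {..degree R}. fls_of_poly (coeff P i) * w ^ i = 0"
      by simp
  qed simp
  also have "\<dots> = poly_fls P w"
    by (rule poly_fls_altdef[symmetric]) simp
  finally show "poly_fls R w ^ ?p = poly_fls P w" .
qed

text \<open>
  If \<open>P(x, w) = 0\<close>, then \<open>P\<^sub>x(x, w) + P\<^sub>T(x, w) w' = 0\<close>, and this determines \<open>w'\<close> unless
  \<open>P\<^sub>T(x, w) = 0\<close>. In that case, a \<open>P\<close> of least degree in \<open>T\<close>, and among these with leading
  coefficient of least degree, has \<open>P\<^sub>T = 0\<close> and then \<open>P\<^sub>x = 0\<close>. But then \<open>P\<close> is the \<open>p\<close>-th power of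
  a polynomial of smaller degree, which also vanishes at \<open>w\<close>.
\<close>

lemma algebraic_over_fls_deriv:
  fixes w :: "'p::prime_card mod_ring fls"
  assumes "algebraic_over (field_gen {fls_X}) w"
  shows "algebraic_over (field_gen {fls_X}) (fls_deriv w)"
proof -
  define Z where "Z = {P :: 'p mod_ring poly poly. P \<noteq> 0 \<and> poly_fls P w = 0}"
  define r where "r = measures [degree :: 'p mod_ring poly poly \<Rightarrow> nat, \<lambda>P. degree (coeff P (degree P))]"
  obtain P0 where "P0 \<in> Z"
    using algebraic_over_X_equation[OF assms] by (auto simp: Z_def)
  have "wf r" by (simp add: r_def)
  obtain P where P: "P \<in> Z" and min: "\<And>Q. (Q, P) \<in> r \<Longrightarrow> Q \<notin> Z"
    using wfE_min[OF \<open>wf r\<close> \<open>P0 \<in> Z\<close>] by blast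
  have less: "Q \<notin> Z" if "degree Q < degree P" for Q
    using min[of Q] that by (simp add: r_def)
  have Pw: "P \<noteq> 0" "poly_fls P w = 0" using P by (simp_all add: Z_def)
  have degP: "degree P > 0"
  proof (rule ccontr)
    assume "\<not> degree P > 0"
    then obtain c where "P = [:c:]" using degree_eq_zeroE[of P] by blast
    then show False using Pw by simp
  qed
  have eq: "poly_fls (map_poly pderiv P) w + poly_fls (pderiv P) w * fls_deriv w = 0"
    using fls_deriv_poly_fls[of P w] Pw(2) by simp
  have "poly_fls (pderiv P) w \<noteq> 0"
  proof
    assume 0: "poly_fls (pderiv P) w = 0"
    have "degree (pderiv P) < degree P"
      using degree_pderiv_le[of P] degP by linarith
    with less 0 have T: "pderiv P = 0" by (auto simp: Z_def)
    have "map_poly pderiv P \<notin> Z"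
    proof
      assume Z: "map_poly pderiv P \<in> Z"
      have "degree (map_poly pderiv P) \<le> degree P" by (rule degree_map_poly_le)
      with less Z have deg: "degree (map_poly pderiv P) = degree P"
        by (metis le_neq_implies_less)
      have lc: "coeff (map_poly pderiv P) (degree P) = pderiv (coeff P (degree P))"
        by (simp add: coeff_map_poly)
      moreover have "coeff (map_poly pderiv P) (degree P) \<noteq> 0"
        using Z deg by (metis (mono_tags, lifting) Z_def leading_coeff_neq_0 mem_Collect_eq)
      ultimately have "pderiv (coeff P (degree P)) \<noteq> 0" by simp
      then have "degree (coeff P (degree P)) \<noteq> 0"
        by (metis degree_eq_zeroE pderiv_singleton)
      then have "degree (pderiv (coeff P (degree P))) < degree (coeff P (degree P))"
        using degree_pderiv_le[of "coeff P (degree P)"] by linarith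
      then have "(map_poly pderiv P, P) \<in> r"
        by (simp add: r_def deg lc)
      with min Z show False by blast
    qed
    with eq 0 have X: "map_poly pderiv P = 0" by (auto simp: Z_def)
    define R where "R = frobenius_root (frobenius_root id CARD('p)) CARD('p) P"
    note root = poly_fls_frobenius_root[OF T X, folded R_def]
    have "poly_fls R w = 0" using root(1)[of w] Pw(2) by simp
    then have "R \<in> Z" using root(3) Pw(1) by (simp add: Z_def)
    moreover have "degree R < degree P"
      using root(2) degP prime_gt_1_nat[OF prime_card[where 'a='p]]
      by (cases "degree R = 0") (auto intro: less_le_trans[of _ "CARD('p) * degree R"])
    ultimately show False using less by blast
  qed
  then have "fls_deriv w = - (poly_fls (map_poly pderiv P) w * inverse (poly_fls (pderiv P) w))"
    using eq by (simp add: field_simps eq_neg_iff_add_eq_0)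
  also have "algebraic_over (field_gen {fls_X}) \<dots>"
    using assms by (intro algebraic_over_field_ops algebraic_over_poly_fls)
  finally show ?thesis .
qed

section \<open>Solving the equation up to constants\<close>

definition algebraic_fps :: "'k::field fps \<Rightarrow> bool"
  where "algebraic_fps f \<longleftrightarrow> algebraic_over (field_gen {fls_X}) (fps_to_fls f)"

definition euler :: "'a::comm_ring_1 fps \<Rightarrow> 'a fps"
  where "euler f = fps_X * fps_deriv f"

lemma euler_nth [simp]: "euler f $ n = of_nat n * f $ n"
  by (cases n) (simp_all add: euler_def)

lemma euler_pow_nth: "(euler ^^ k) f $ n = of_nat n ^ k * f $ n"
  by (induction k) (simp_all add: mult.assoc)

lemma euler_mult: "euler (f * g) = f * euler g + euler f * g"
  by (simp add: euler_def algebra_simps)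

lemma algebraic_fps_X: "algebraic_fps fps_X"
  by (simp add: algebraic_fps_def algebraic_over_self field_gen.incl)

lemma algebraic_fps_1: "algebraic_fps 1"
  by (simp add: algebraic_fps_def algebraic_over_self field_gen.one)

lemma algebraic_fps_diff: "algebraic_fps f \<Longrightarrow> algebraic_fps g \<Longrightarrow> algebraic_fps (f - g)"
  by (simp add: algebraic_fps_def algebraic_over_diff)

lemma algebraic_fps_mult: "algebraic_fps f \<Longrightarrow> algebraic_fps g \<Longrightarrow> algebraic_fps (f * g)"
  by (simp add: algebraic_fps_def fls_times_fps_to_fls algebraic_over_field_ops)

lemma algebraic_fps_deriv:
  fixes f :: "'p::prime_card mod_ring fps"
  shows "algebraic_fps f \<Longrightarrow> algebraic_fps (fps_deriv f)"
  using algebraic_over_fls_deriv[of "fps_to_fls f"]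
  by (simp add: algebraic_fps_def fls_deriv_fps_to_fls)

lemma algebraic_fps_euler:
  fixes f :: "'p::prime_card mod_ring fps"
  shows "algebraic_fps f \<Longrightarrow> algebraic_fps (euler f)"
  by (simp add: euler_def algebraic_fps_mult algebraic_fps_X algebraic_fps_deriv)

text \<open>
  The equation \<open>\<theta> u = g u\<close>, where \<open>\<theta> = x d/dx\<close>, says that \<open>u\<close> lies in the kernel of
  \<open>\<nabla> = \<theta> - g\<close>. This operator is conjugate to \<open>\<theta>\<close> if the equation has an invertible solution, and
  \<open>\<theta>\<^sup>p = \<theta>\<close> by Fermat's little theorem. Hence \<open>\<nabla>\<^sup>p = \<nabla>\<close> whenever \<open>g\<close> is a logarithmic derivative.
\<close>

definition twisted :: "'a::comm_ring_1 fps \<Rightarrow> 'a fps \<Rightarrow> 'a fps"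
  where "twisted g w = euler w - g * w"

lemma twisted_nth: "twisted g w $ n = of_nat n * w $ n - (g * w) $ n"
  by (simp add: twisted_def)

lemma algebraic_fps_twisted:
  fixes g :: "'p::prime_card mod_ring fps"
  shows "algebraic_fps g \<Longrightarrow> algebraic_fps w \<Longrightarrow> algebraic_fps (twisted g w)"
  by (simp add: twisted_def algebraic_fps_diff algebraic_fps_mult algebraic_fps_euler)

lemma twisted_cong:
  assumes "\<And>m. m \<le> N \<Longrightarrow> g $ m = h $ m" "n \<le> N"
  shows "(twisted g ^^ k) w $ n = (twisted h ^^ k) w $ n"
  using assms(2)
proof (induction k arbitrary: n)
  case (Suc k)
  have "(g * (twisted g ^^ k) w) $ n = (h * (twisted h ^^ k) w) $ n"
    unfolding fps_mult_nth using Suc assms(1) by (intro sum.cong) auto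
  then show ?case using Suc by (simp add: twisted_nth)
qed simp

lemma twisted_pow_mult:
  assumes "euler v = h * v"
  shows "(twisted h ^^ k) (v * w) = v * (euler ^^ k) w"
  by (induction k) (simp_all add: twisted_def euler_mult assms algebra_simps)

lemma euler_pow_card: "(euler ^^ CARD('p)) w = euler (w :: 'p::prime_card mod_ring fps)"
proof (rule fps_ext)
  fix n
  show "(euler ^^ CARD('p)) w $ n = euler w $ n" by (simp add: euler_pow_nth)
qed

lemma twisted_pow_card_if_solution:
  fixes v :: "'p::prime_card mod_ring fps"
  assumes "euler v = h * v" "v $ 0 = 1"
  shows "(twisted h ^^ CARD('p)) w = twisted h w"
proof -
  have w: "w = v * (inverse v * w)"
    using assms(2) by (simp add: inverse_mult_eq_1' flip: mult.assoc)
  have "(twisted h ^^ CARD('p)) (v * (inverse v * w)) = v * euler (inverse v * w)"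
    unfolding twisted_pow_mult[OF assms(1)] euler_pow_card ..
  also have "\<dots> = twisted h (v * (inverse v * w))"
    using twisted_pow_mult[OF assms(1), of 1] by simp
  finally show ?thesis by (simp flip: w)
qed

text \<open>
  The coefficients of the logarithmic derivative \<open>- \<Sum>\<^sub>j m \<epsilon>\<^sup>j x\<^bsup>mj\<^esup>\<close> of \<open>1 - \<epsilon> x\<^sup>m\<close> at \<open>n\<close> and at
  \<open>p n\<close> agree, because \<open>m\<close> is prime to \<open>p\<close> and \<open>\<epsilon>\<^sup>p = \<epsilon>\<close>.
\<close>

lemma one_minus_monomial_log_derivative:
  fixes \<epsilon> :: "'p::prime_card mod_ring"
  assumes "m > 0" "coprime m CARD('p)"
  defines "k \<equiv> Abs_fps (\<lambda>n. if m dvd n \<and> n > 0 then - of_nat m * \<epsilon> ^ (n div m) else 0)"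
  shows "euler (1 - fps_const \<epsilon> * fps_X ^ m) = k * (1 - fps_const \<epsilon> * fps_X ^ m)"
    and "k $ (CARD('p) * n) = k $ n"
proof -
  show "euler (1 - fps_const \<epsilon> * fps_X ^ m) = k * (1 - fps_const \<epsilon> * fps_X ^ m)"
  proof (rule fps_ext)
    fix n
    have "euler (1 - fps_const \<epsilon> * fps_X ^ m) $ n = (if n = m then - of_nat m * \<epsilon> else 0)"
      by (simp add: fps_X_power_nth)
    moreover have "(k * (1 - fps_const \<epsilon> * fps_X ^ m)) $ n = k $ n - \<epsilon> * (if n < m then 0 else k $ (n - m))"
      by (simp add: right_diff_distrib mult.left_commute[of k] fps_X_power_mult_right_nth)
    moreover have "k $ n - \<epsilon> * (if n < m then 0 else k $ (n - m)) = (if n = m then - of_nat m * \<epsilon> else 0)"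
    proof (cases "m dvd n")
      case True
      then obtain j where j: "n = m * j" by blast
      consider "j = 0" | "j = 1" | i where "j = Suc (Suc i)" by (metis One_nat_def not0_implies_Suc)
      then show ?thesis
      proof cases
        case 3
        then have "n - m = m * Suc i" "\<not> n < m" "n > 0" "n \<noteq> m" "n div m = Suc (Suc i)"
          using assms(1) by (auto simp: j)
        then show ?thesis using assms(1) True by (auto simp: k_def)
      qed (use assms(1) in \<open>auto simp: j k_def\<close>)
    next
      case False
      then have "\<not> m dvd n - m" if "\<not> n < m" using that by (simp add: dvd_minus_self)
      with False show ?thesis by (auto simp: k_def)
    qed
    ultimately show "euler (1 - fps_const \<epsilon> * fps_X ^ m) $ n = (k * (1 - fps_const \<epsilon> * fps_X ^ m)) $ n"
      by simp
  qed
  have "m dvd CARD('p) * n \<longleftrightarrow> m dvd n"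
    using assms(2) by (simp add: coprime_dvd_mult_right_iff)
  moreover have "\<epsilon> ^ (CARD('p) * n div m) = \<epsilon> ^ (n div m)" if "m dvd n"
    using that by (simp add: div_mult_swap[symmetric] power_mult)
  ultimately show "k $ (CARD('p) * n) = k $ n"
    by (simp add: k_def)
qed

text \<open>
  If \<open>g\<close> has the same coefficient at \<open>n\<close> and at \<open>p n\<close> for all \<open>n\<close>, it is a logarithmic derivative to
  any order. A factor \<open>1 - \<epsilon> x\<^sup>m\<close> corrects the coefficient at an \<open>m\<close> prime to \<open>p\<close>; at multiples of
  \<open>p\<close> there is nothing to correct, as \<open>g\<close> and the logarithmic derivatives of these factors have the
  same symmetry.
\<close>

lemma approximate_solution:
  fixes g :: "'p::prime_card mod_ring fps"
  assumes g0: "g $ 0 = 0" and gp: "\<And>n. g $ (CARD('p) * n) = g $ n"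
  shows "\<exists>v h. v $ 0 = 1 \<and> euler v = h * v \<and> (\<forall>n. h $ (CARD('p) * n) = h $ n) \<and>
           (\<forall>n\<le>N. g $ n = h $ n)"
proof (induction N)
  case 0
  show ?case using g0 by (intro exI[of _ 1] exI[of _ 0]) (auto simp: euler_def)
next
  case (Suc N)
  let ?p = "CARD('p)" and ?m = "Suc N"
  have p: "prime ?p" by (rule prime_card)
  obtain v h where vh: "v $ 0 = 1" "euler v = h * v" "\<And>n. h $ (?p * n) = h $ n"
    "\<And>n. n \<le> N \<Longrightarrow> g $ n = h $ n" using Suc.IH by blast
  show ?case
  proof (cases "?p dvd ?m")
    case True
    then obtain j where j: "?m = ?p * j" by blast
    then have "j > 0" by (cases j) auto
    then have "j < ?p * j" using prime_gt_1_nat[OF p] by simp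
    then have "j \<le> N" unfolding j[symmetric] by simp
    then have "g $ ?m = h $ ?m" unfolding j using gp vh(3,4) by simp
    then have "g $ n = h $ n" if "n \<le> ?m" for n
      using that vh(4) by (cases "n = ?m") auto
    then show ?thesis using vh(1-3) by blast
  next
    case False
    define \<epsilon> where "\<epsilon> = (h $ ?m - g $ ?m) / of_nat ?m"
    have "(of_nat ?m :: 'p mod_ring) \<noteq> 0"
      using False by (simp add: of_nat_eq_0_iff_char_dvd del: of_nat_Suc)
    then have \<epsilon>: "- of_nat ?m * \<epsilon> = g $ ?m - h $ ?m" by (simp add: \<epsilon>_def del: of_nat_Suc)
    have "coprime ?m ?p" using p False by (simp add: coprime_commute prime_imp_coprime)
    note k = one_minus_monomial_log_derivative[OF zero_less_Suc this, of \<epsilon>]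
    define k where "k = Abs_fps (\<lambda>n. if ?m dvd n \<and> n > 0 then - of_nat ?m * \<epsilon> ^ (n div ?m) else 0)"
    let ?v = "(1 - fps_const \<epsilon> * fps_X ^ ?m) * v" and ?h = "h + k"
    have "?v $ 0 = 1" using vh(1) by simp
    moreover have "euler ?v = ?h * ?v"
      unfolding euler_mult k(1) k_def[symmetric] vh(2) by (simp add: algebra_simps)
    moreover have "?h $ (?p * n) = ?h $ n" for n
      using k(2) vh(3) unfolding k_def fps_add_nth by simp
    moreover have "g $ n = ?h $ n" if "n \<le> ?m" for n
    proof (cases "n = ?m")
      case True
      then show ?thesis using \<epsilon> by (simp add: k_def del: of_nat_Suc)
    next
      case False
      with that have "n \<le> N" by simp
      then have "\<not> (?m dvd n \<and> n > 0)" using nat_dvd_not_less[of n ?m] by auto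
      then have "k $ n = 0" unfolding k_def by auto
      then show ?thesis using vh(4)[OF \<open>n \<le> N\<close>] by simp
    qed
    ultimately show ?thesis by blast
  qed
qed

text \<open>
  The coefficients of \<open>\<nabla>\<^sup>p w\<close> up to a given order depend on those of \<open>g\<close> up to the same order only,
  so approximate solutions suffice.
\<close>

lemma twisted_pow_card:
  fixes g :: "'p::prime_card mod_ring fps"
  assumes "g $ 0 = 0" "\<And>n. g $ (CARD('p) * n) = g $ n"
  shows "(twisted g ^^ CARD('p)) w = twisted g w"
proof (rule fps_ext)
  fix n
  obtain v h where vh: "v $ 0 = 1" "euler v = h * v" "\<And>m. m \<le> n \<Longrightarrow> g $ m = h $ m"
    using approximate_solution[of g n] assms by blast
  have "(twisted g ^^ CARD('p)) w $ n = (twisted h ^^ CARD('p)) w $ n"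
    by (rule twisted_cong[OF vh(3)]) auto
  also have "\<dots> = twisted h w $ n"
    by (simp add: twisted_pow_card_if_solution[OF vh(2,1)])
  also have "\<dots> = twisted g w $ n"
    using twisted_cong[where k = 1 and w = w, OF vh(3)] by simp
  finally show "(twisted g ^^ CARD('p)) w $ n = twisted g w $ n" .
qed

text \<open>
  Since \<open>\<nabla>\<^sup>p = \<nabla>\<close>, the operator \<open>1 - \<nabla>\<^bsup>p-1\<^esup>\<close> maps into the kernel of \<open>\<nabla>\<close>. Applied to \<open>1\<close>, it gives
  a solution that is a polynomial in \<open>g\<close> and its derivatives, and therefore algebraic.
\<close>

lemma algebraic_solution:
  fixes g :: "'p::prime_card mod_ring fps"
  assumes g: "g $ 0 = 0" "\<And>n. g $ (CARD('p) * n) = g $ n" and alg: "algebraic_fps g"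
  obtains u where "u $ 0 = 1" "euler u = g * u" "algebraic_fps u"
proof -
  let ?p = "CARD('p)"
  have p: "?p > 1" by (rule prime_gt_1_nat[OF prime_card])
  define u where "u = 1 - (twisted g ^^ (?p - 1)) 1"
  define k where "k = ?p - 2"
  have k: "?p - 1 = Suc k" "?p = Suc (Suc k)" using p by (simp_all add: k_def)
  have tw: "twisted g ((twisted g ^^ (?p - 1)) 1) = (twisted g ^^ ?p) 1"
    unfolding k(1) by (subst k(2)) (simp only: funpow.simps comp_def)
  have "twisted g u = twisted g 1 - twisted g ((twisted g ^^ (?p - 1)) 1)"
    by (simp add: u_def twisted_def euler_def algebra_simps)
  also have "\<dots> = 0" unfolding tw twisted_pow_card[OF g] by simp
  finally have "euler u = g * u" by (simp add: twisted_def)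
  moreover have "u $ 0 = 1"
  proof -
    have "(twisted g ^^ Suc k) 1 $ 0 = 0"
      using g(1) by (simp add: twisted_nth)
    then show ?thesis unfolding u_def k(1) by simp
  qed
  moreover have "algebraic_fps ((twisted g ^^ k) 1)" for k
    by (induction k) (simp_all add: algebraic_fps_1 algebraic_fps_twisted alg)
  then have "algebraic_fps u"
    unfolding u_def by (intro algebraic_fps_diff algebraic_fps_1)
  ultimately show ?thesis using that by blast
qed

text \<open>
  The passage from \<open>g\<close> to \<open>g - g\<^sup>p\<close> removes the coefficients at multiples of \<open>p\<close>, and \<open>\<theta>\<^bsup>p-1\<^esup>\<close> does
  the same to \<open>b\<close>. So \<open>g\<close> satisfies the Artin-Schreier equation \<open>g - g\<^sup>p = \<theta>\<^bsup>p-1\<^esup> b\<close>, which makes it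
  algebraic.
\<close>

lemma algebraic_logarithmic_part:
  fixes b :: "'p::prime_card mod_ring fps"
  assumes b0: "b $ 0 = 0" and alg: "algebraic_fps b"
  obtains g where "g $ 0 = 0" "\<And>n. g $ (CARD('p) * n) = g $ n"
    "\<And>n. \<not> CARD('p) dvd n \<Longrightarrow> g $ n = b $ n" "algebraic_fps g"
proof -
  let ?p = "CARD('p)"
  have p: "prime ?p" by (rule prime_card)
  \<comment> \<open>The symmetry and the agreement with \<open>b\<close> force the coefficient at \<open>n\<close> to be that of \<open>b\<close>
    at the part of \<open>n\<close> prime to \<open>p\<close>.\<close>
  define g where "g = Abs_fps (\<lambda>n. b $ (n div ?p ^ multiplicity ?p n))"
  have g0: "g $ 0 = 0" by (simp add: g_def b0)
  have gp: "g $ (?p * n) = g $ n" for n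
  proof (cases "n = 0")
    case False
    then have "multiplicity ?p (?p * n) = Suc (multiplicity ?p n)"
      using p by (intro multiplicity_times_same) auto
    then show ?thesis using p by (simp add: g_def)
  qed simp
  have gb: "g $ n = b $ n" if "\<not> ?p dvd n" for n
    using that by (simp add: g_def not_dvd_imp_multiplicity_0)
  define c where "c = (euler ^^ (?p - 1)) b"
  have "g ^ ?p + c = g"
  proof (rule fps_ext)
    fix n
    have n: "(of_nat n :: 'p mod_ring) = 0 \<longleftrightarrow> ?p dvd n"
      by (simp add: of_nat_eq_0_iff_char_dvd)
    have "(of_nat n :: 'p mod_ring) * of_nat n ^ (?p - 1) = of_nat n"
      using power_Suc[of "of_nat n :: 'p mod_ring" "?p - 1"] prime_gt_0_nat[OF p] by simp
    then have "(of_nat n :: 'p mod_ring) ^ (?p - 1) = (if ?p dvd n then 0 else 1)"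
      using n prime_gt_1_nat[OF p] by (auto simp: power_0_left)
    then show "(g ^ ?p + c) $ n = g $ n"
      using gp[of "n div ?p", symmetric] gb[of n]
      by (cases "?p dvd n") (simp_all add: fps_power_card_nth c_def euler_pow_nth)
  qed
  then have root: "fps_to_fls g ^ ?p + fps_to_fls c = fps_to_fls g"
    by (metis fps_to_fls_plus fps_to_fls_power)
  have algc: "algebraic_fps ((euler ^^ k) b)" for k
    by (induction k) (simp_all add: alg algebraic_fps_euler)
  define P where "P = Polynomial.monom 1 ?p - Polynomial.monom 1 1 + [:fps_to_fls c:]"
  have "coeff P ?p = 1"
    using prime_gt_1_nat[OF p] by (simp add: P_def coeff_pCons split: nat.split)
  then have P: "P \<noteq> 0" by auto
  have "poly P (fps_to_fls g) = 0"
    using root by (simp add: P_def poly_monom algebra_simps)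
  moreover have "algebraic_over (field_gen {fls_X}) (coeff P n)" for n
  proof -
    have 01: "algebraic_over (field_gen {fls_X}) (if A then (1::'p mod_ring fls) else 0)" for A
      by (simp add: algebraic_over_self field_gen.one field_gen_zero)
    have "coeff P n = (if ?p = n then 1 else 0) - (if 1 = n then 1 else 0) + (if n = 0 then fps_to_fls c else 0)"
      by (simp add: P_def coeff_pCons split: nat.split)
    then show ?thesis
      using 01[of True] 01[of False] algc[of "?p - 1"]
      by (auto simp: c_def algebraic_fps_def intro!: algebraic_over_field_ops algebraic_over_diff)
  qed
  ultimately have "algebraic_fps g"
    unfolding algebraic_fps_def using algebraic_over_trans[OF subfield_field_gen P] by simp
  with g0 gp gb show ?thesis using that by blast
qed

text \<open>
  Subtracting a constant \<open>h\<close> from \<open>b\<close> makes it a logarithmic derivative. This proposition is used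
  twice: for \<open>b = x a\<close>, and for \<open>b = x\<close> to obtain a substitute for the exponential series.
\<close>

proposition algebraic_solution_modulo_constants:
  fixes b :: "'p::prime_card mod_ring fps"
  assumes b0: "b $ 0 = 0" and alg: "algebraic_fps b"
  obtains h u where "h $ 0 = 0" "fps_deriv h = 0" "u $ 0 = 1" "euler u = (b - h) * u"
    "algebraic_fps h" "algebraic_fps u"
proof -
  obtain g where g: "g $ 0 = 0" "\<And>n. g $ (CARD('p) * n) = g $ n"
    "\<And>n. \<not> CARD('p) dvd n \<Longrightarrow> g $ n = b $ n" "algebraic_fps g"
    using algebraic_logarithmic_part[OF assms] by blast
  obtain u where u: "u $ 0 = 1" "euler u = g * u" "algebraic_fps u"
    using algebraic_solution[OF g(1,2,4)] by blast
  have "fps_deriv (b - g) = 0"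
  proof (rule fps_ext)
    fix n
    show "fps_deriv (b - g) $ n = 0 $ n"
      using g(3)[of "Suc n"] by (cases "CARD('p) dvd Suc n")
        (simp_all add: of_nat_eq_0_iff_char_dvd del: of_nat_Suc)
  qed
  with u g(1) b0 show ?thesis
    using algebraic_fps_diff[OF alg g(4)] by (intro that[of "b - g" u]) simp_all
qed

section \<open>Coefficientwise ring homomorphisms\<close>

lemma fps_map_nth [simp]: "fps_map \<phi> f $ n = \<phi> (f $ n)"
  by (simp add: fps_map_def)

lemma comm_ring_hom_fps_map:
  assumes "comm_ring_hom \<phi>"
  shows "comm_ring_hom (fps_map \<phi>)"
proof -
  interpret comm_ring_hom \<phi> by (rule assms)
  show ?thesis
    by unfold_locales (auto intro!: fps_ext simp: fps_mult_nth hom_distribs)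
qed

lemma fps_map_fps_compose:
  assumes "comm_ring_hom \<phi>"
  shows "fps_map \<phi> (f oo t) = fps_map \<phi> f oo fps_map \<phi> t"
proof (rule fps_ext)
  fix n
  interpret comm_ring_hom \<phi> by (rule assms)
  interpret F: comm_ring_hom "fps_map \<phi>" by (rule comm_ring_hom_fps_map[OF assms])
  show "fps_map \<phi> (f oo t) $ n = (fps_map \<phi> f oo fps_map \<phi> t) $ n"
    by (simp add: fps_compose_nth hom_distribs flip: F.hom_power)
qed

lemma comm_ring_hom_zconst: "comm_ring_hom (zconst :: 'k::comm_ring_1 \<Rightarrow> 'k zpoly)"
  by unfold_locales (simp_all add: single_add mult_single)

lemma comm_ring_hom_zsubst: "comm_ring_hom (zsubst s :: 'k::comm_ring_1 zpoly \<Rightarrow> 'k zpoly)"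
proof unfold_locales
  show "zsubst s (1 :: 'k zpoly) = 1" using zsubst_zconst[of s "1::'k"] by simp
  show "zsubst s (0 :: 'k zpoly) = 0" by (simp add: zsubst_def)
qed (simp_all add: zsubst_add zsubst_mult)

lemma comm_ring_hom_zl_of_fps: "comm_ring_hom (zl_of_fps :: 'k::field zpoly fps \<Rightarrow> 'k zlaurent)"
proof -
  have "comm_ring_hom (to_fract :: 'k zpoly \<Rightarrow> 'k zfrac)"
    by unfold_locales simp_all
  then interpret comm_ring_hom "fps_map (to_fract :: 'k zpoly \<Rightarrow> 'k zfrac)"
    by (rule comm_ring_hom_fps_map)
  show ?thesis
    by unfold_locales (simp_all add: zl_of_fps_def hom_distribs fls_times_fps_to_fls)
qed

global_interpretation zl_of_fps: comm_ring_hom "zl_of_fps :: 'k::field zpoly fps \<Rightarrow> 'k zlaurent"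
  by (rule comm_ring_hom_zl_of_fps)

lemma zl_of_fps_nth: "zl_of_fps f $$ n = (if n < 0 then 0 else to_fract (f $ nat n))"
  by (simp add: zl_of_fps_def)

abbreviation fps_zconst :: "'k::comm_ring_1 fps \<Rightarrow> 'k zpoly fps"
  where "fps_zconst \<equiv> fps_map zconst"

global_interpretation fps_zconst: comm_ring_hom "fps_zconst :: 'k::comm_ring_1 fps \<Rightarrow> 'k zpoly fps"
  by (rule comm_ring_hom_fps_map[OF comm_ring_hom_zconst])

lemma fps_zconst_simps [simp]:
  "fps_zconst fps_X = fps_X" "fps_zconst (fps_const c) = fps_const (zconst c)"
  by (auto intro!: fps_ext simp: fps_X_def)

lemma fps_zconst_eq_0_iff [simp]: "fps_zconst f = 0 \<longleftrightarrow> f = 0"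
proof
  assume "fps_zconst f = 0"
  then have "zconst (f $ n) = 0" for n by (metis fps_map_nth fps_zero_nth)
  then show "f = 0" by (metis fps_ext fps_zero_nth lookup_single_eq lookup_zero)
qed simp

lemma zl_of_fls_fps: "zl_of_fls (fps_to_fls f) = zl_of_fps (fps_zconst f)"
  by (rule fls_eqI) (simp add: zl_of_fls_def fls_map_nth zl_of_fps_nth)

lemma zl_of_fps_const: "zl_of_fps (fps_const c) = fls_const (to_fract c)"
  by (rule fls_eqI) (simp add: zl_of_fps_nth)

lemma zl_of_fps_X: "zl_of_fps fps_X = fls_X"
  by (rule fls_eqI) (auto simp: zl_of_fps_nth fps_X_def nat_eq_iff)

lemma zl_of_fps_zvar: "zl_of_fps (fps_const (zvar j)) = zl_var j"
  by (simp add: zl_of_fps_const zl_var_def)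

section \<open>The derivation on composed series\<close>

text \<open>
  The series 0 vanishes below every \<open>m\<close>, whereas its subdegree is 0 by convention.
\<close>

definition vanishes_below :: "int \<Rightarrow> 'a::zero fls \<Rightarrow> bool"
  where "vanishes_below m F \<longleftrightarrow> (\<forall>k<m. F $$ k = 0)"

lemma vanishes_below_mono: "vanishes_below m F \<Longrightarrow> l \<le> m \<Longrightarrow> vanishes_below l F"
  by (simp add: vanishes_below_def)

lemma vanishes_below_diff:
  "vanishes_below m F \<Longrightarrow> vanishes_below m G \<Longrightarrow> vanishes_below m (F - G :: 'a::ab_group_add fls)"
  by (simp add: vanishes_below_def)

lemma vanishes_below_mult:
  assumes "vanishes_below m F" "vanishes_below l G"
  shows "vanishes_below (m + l) (F * G :: 'a::idom fls)"
proof (cases "F = 0 \<or> G = 0")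
  case False
  then have "fls_subdegree F \<ge> m" "fls_subdegree G \<ge> l"
    using assms by (auto simp: vanishes_below_def intro: fls_subdegree_geI)
  with False show ?thesis
    by (simp add: vanishes_below_def)
qed (auto simp: vanishes_below_def)

lemma vanishes_below_zl_of_fps: "vanishes_below 0 (zl_of_fps f)"
  by (simp add: vanishes_below_def zl_of_fps_nth)

lemma vanishes_below_zl_of_fps':
  "(\<And>k. k < m \<Longrightarrow> f $ k = 0) \<Longrightarrow> vanishes_below (int m) (zl_of_fps f)"
  by (simp add: vanishes_below_def zl_of_fps_nth)

lemma vanishes_below_zlaurent_deriv:
  "vanishes_below m F \<Longrightarrow> vanishes_below (m - 1) (zlaurent_deriv F)"
  by (simp add: vanishes_below_def zlaurent_deriv_nth)

lemma vanishes_below_all: "(\<And>m::nat. vanishes_below (int m - c) F) \<Longrightarrow> F = 0"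
proof (rule fls_eqI)
  fix n assume "\<And>m::nat. vanishes_below (int m - c) F"
  from this[of "nat (n + c + 1)"] show "F $$ n = 0 $$ n"
    by (simp add: vanishes_below_def)
qed

lemma zlaurent_deriv_diff: "zlaurent_deriv (F - G) = zlaurent_deriv F - zlaurent_deriv G"
  using zlaurent_deriv_add[of "F - G" G] by (simp add: algebra_simps)

lemma fps_zconst_compose_split:
  fixes t :: "'k::field zpoly fps"
  assumes "t $ 0 = 0"
  shows "fps_zconst (fps_const c + fps_X * f) oo t = fps_const (zconst c) + t * (fps_zconst f oo t)"
  using assms
  by (simp add: fps_zconst.hom_add fps_zconst.hom_mult fps_compose_add_distrib fps_compose_mult_distrib)

text \<open>
  Let \<open>E f\<close> be the difference of both sides. Splitting off the constant term, \<open>f = c + x f\<^sub>1\<close>, gives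
  \<open>E f = t E f\<^sub>1\<close>. As all \<open>E f\<close> have a pole of order at most 1 and \<open>t\<close> vanishes at 0, iterating this
  shows that \<open>E f\<close> is divisible by every power of \<open>x\<close>.
\<close>

lemma zlaurent_deriv_compose:
  fixes t :: "'k::field zpoly fps"
  assumes t: "t $ 0 = 0"
  shows "zlaurent_deriv (zl_of_fps (fps_zconst f oo t)) =
    zl_of_fps (fps_zconst (fps_deriv f) oo t) * zlaurent_deriv (zl_of_fps t)"
proof -
  define E where "E = (\<lambda>f. zlaurent_deriv (zl_of_fps (fps_zconst f oo t)) -
    zl_of_fps (fps_zconst (fps_deriv f) oo t) * zlaurent_deriv (zl_of_fps t))"
  have Zt: "vanishes_below 1 (zl_of_fps t)"
    using vanishes_below_zl_of_fps'[of 1 t] t by simp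
  have step: "E f = zl_of_fps t * E (fps_shift 1 f)" for f
  proof -
    define c f1 where "c = f $ 0" "f1 = fps_shift 1 f"
    have f: "f = fps_const c + fps_X * f1"
      by (rule fps_ext) (simp add: c_f1_def)
    have f': "fps_deriv f = f1 + fps_X * fps_deriv f1"
      unfolding f by simp
    have "fps_zconst (fps_deriv f) oo t = (fps_zconst f1 oo t) + t * (fps_zconst (fps_deriv f1) oo t)"
      unfolding f' using t
      by (simp add: fps_zconst.hom_add fps_zconst.hom_mult fps_compose_add_distrib fps_compose_mult_distrib)
    moreover have "zlaurent_deriv (zl_of_fps (fps_zconst f oo t)) =
      zl_of_fps t * zlaurent_deriv (zl_of_fps (fps_zconst f1 oo t)) +
      zlaurent_deriv (zl_of_fps t) * zl_of_fps (fps_zconst f1 oo t)"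
      unfolding f fps_zconst_compose_split[OF t]
      by (simp add: zl_of_fps.hom_add zl_of_fps.hom_mult zlaurent_deriv_add zlaurent_deriv_mult
          zl_of_fps_const zlaurent_deriv_const[unfolded zl_const_def])
    ultimately show ?thesis
      unfolding E_def c_f1_def(2)[symmetric]
      by (simp add: zl_of_fps.hom_add zl_of_fps.hom_mult algebra_simps)
  qed
  have "vanishes_below (int N - 1) (E f)" for N f
  proof (induction N arbitrary: f)
    case 0
    have "vanishes_below (0 + 0) (zl_of_fps (fps_zconst (fps_deriv f) oo t) * zlaurent_deriv (zl_of_fps t))"
      using vanishes_below_zlaurent_deriv[OF Zt]
      by (intro vanishes_below_mult vanishes_below_zl_of_fps) simp
    then show ?case
      using vanishes_below_zlaurent_deriv[OF vanishes_below_zl_of_fps[of "fps_zconst f oo t"]]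
      unfolding E_def by (intro vanishes_below_diff) (auto elim: vanishes_below_mono)
  next
    case (Suc N)
    then show ?case
      using vanishes_below_mult[OF Zt Suc.IH[of "fps_shift 1 f"]] by (simp add: step[of f])
  qed
  then have "E f = 0" by (rule vanishes_below_all)
  then show ?thesis by (simp add: E_def)
qed

lemma zlaurent_deriv_fps_zconst:
  "zlaurent_deriv (zl_of_fps (fps_zconst f)) = zl_of_fps (fps_zconst (fps_deriv (f :: 'k::field fps)))"
  using zlaurent_deriv_compose[of fps_X f] by (simp add: zl_of_fps_X zlaurent_deriv_X)

section \<open>Composition preserves algebraicity\<close>

lemma zl_of_fps_eq_0_iff [simp]: "zl_of_fps f = 0 \<longleftrightarrow> f = 0"
proof
  assume "zl_of_fps f = 0"
  then have "to_fract (f $ n) = 0" for n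
    using zl_of_fps_nth[of f "int n"] by simp
  then show "f = 0" by (intro fps_ext) simp
qed simp

lemma zl_const_field_gen: "zl_of_fps (fps_const (zconst (c :: 'p::prime_card mod_ring))) \<in> field_gen S"
proof -
  obtain n where "c = of_nat n" using surj_of_nat_mod_ring by blast
  then have "zl_of_fps (fps_const (zconst c)) = of_nat n"
    by (metis fps_of_nat fps_zconst.hom_of_nat fps_zconst_simps(2) zl_of_fps.hom_of_nat)
  then show ?thesis by (simp add: of_nat_field_gen)
qed

text \<open>
  An equation \<open>P(x, f(x)) = 0\<close> becomes \<open>P(t, f(t)) = 0\<close>. If \<open>t = 0\<close>, then \<open>f(t)\<close> is a
  constant. Otherwise \<open>t\<close> is non-zero without constant term, so
  substituting it for \<open>x\<close> is injective and the new equation is non-trivial. Its coefficients are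
  polynomials in \<open>t\<close> and hence algebraic, and transitivity applies.
\<close>

lemma algebraic_over_compose:
  fixes f :: "'p::prime_card mod_ring fps"
  assumes f: "algebraic_fps f" and t0: "t $ 0 = 0"
    and t: "algebraic_over (field_gen S) (zl_of_fps t)"
  shows "algebraic_over (field_gen S) (zl_of_fps (fps_zconst f oo t))"
proof (cases "t = 0")
  case True
  then show ?thesis by (simp add: algebraic_over_self zl_const_field_gen)
next
  case False
  define \<psi> where "\<psi> = (\<lambda>g :: 'p mod_ring fps. zl_of_fps (fps_zconst g oo t))"
  have \<psi>_0: "\<psi> 0 = 0" by (simp add: \<psi>_def)
  have \<psi>_add: "\<psi> (g + g') = \<psi> g + \<psi> g'" for g g'
    by (simp add: \<psi>_def fps_zconst.hom_add fps_compose_add_distrib zl_of_fps.hom_add)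
  have \<psi>_mult: "\<psi> (g * g') = \<psi> g * \<psi> g'" for g g'
    by (simp add: \<psi>_def fps_zconst.hom_mult fps_compose_mult_distrib[OF t0] zl_of_fps.hom_mult)
  have \<psi>_inj: "\<psi> g = 0 \<longleftrightarrow> g = 0" for g
    using False by (simp add: \<psi>_def fps_compose_eq_0_iff[OF t0])
  have \<psi>_poly: "algebraic_over (field_gen S) (\<psi> (fps_of_poly q))" for q
  proof (induction q)
    case 0
    show ?case by (simp add: \<psi>_0 algebraic_over_self field_gen_zero)
  next
    case (pCons c q)
    have "\<psi> (fps_of_poly (pCons c q)) = zl_of_fps (fps_const (zconst c)) + zl_of_fps t * \<psi> (fps_of_poly q)"
      unfolding fps_of_poly_pCons
      by (simp add: \<psi>_def mult.commute[of _ fps_X] fps_zconst_compose_split[OF t0] zl_of_fps.hom_add zl_of_fps.hom_mult)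
    then show ?case
      using pCons.IH t by (simp add: algebraic_over_field_ops algebraic_over_self zl_const_field_gen)
  qed
  obtain P where P: "P \<noteq> 0" "poly_fls P (fps_to_fls f) = 0"
    using algebraic_over_X_equation f unfolding algebraic_fps_def by blast
  let ?P = "map_poly (\<lambda>q. \<psi> (fps_of_poly q)) P"
  have "fps_of_poly q = 0 \<longleftrightarrow> q = 0" for q :: "'p mod_ring poly"
    by (metis fps_of_poly_0 fps_of_poly_eq_iff)
  then have nz: "coeff ?P i = 0 \<longleftrightarrow> coeff P i = 0" for i
    by (simp add: coeff_map_poly \<psi>_0 \<psi>_inj)
  show ?thesis
  proof (rule algebraic_over_trans[OF subfield_field_gen])
    show "?P \<noteq> 0" using P(1) nz by (metis Polynomial.coeff_0 poly_eqI)
    show "algebraic_over (field_gen S) (coeff ?P i)" for i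
      by (simp add: coeff_map_poly \<psi>_0 \<psi>_poly)
    have "poly (map_poly (\<lambda>q. \<psi> (fps_of_poly q)) Q) (\<psi> f) = \<psi> (poly (map_poly fps_of_poly Q) f)"
      "poly_fls Q (fps_to_fls f) = fps_to_fls (poly (map_poly fps_of_poly Q) f)" for Q
      by (induction Q)
        (simp_all add: \<psi>_0 \<psi>_add \<psi>_mult Polynomial.map_poly_pCons fls_of_poly_def fls_times_fps_to_fls)
    then show "poly ?P (zl_of_fps (fps_zconst f oo t)) = 0"
      using P(2) \<psi>_0 unfolding \<psi>_def by simp
  qed
qed

section \<open>The solution as an infinite product\<close>

text \<open>
  The series \<open>u\<close> solves the given equation up to the constant \<open>h\<^sub>0\<close>. The series \<open>e\<close> takes the place
  of \<open>exp\<close>: it solves \<open>\<theta> e = x e\<close> up to the constant \<open>h\<close>.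
\<close>

locale iterated_log_tower =
  fixes a h\<^sub>0 u h e :: "'p::prime_card mod_ring fps"
  assumes h\<^sub>0: "h\<^sub>0 $ 0 = 0" "fps_deriv h\<^sub>0 = 0" and u: "u $ 0 = 1" "euler u = (fps_X * a - h\<^sub>0) * u"
    and h: "h $ 0 = 0" "fps_deriv h = 0" and e: "e $ 0 = 1" "euler e = (fps_X - h) * e"
begin

abbreviation \<D> :: "'p mod_ring zpoly fps \<Rightarrow> 'p mod_ring zlaurent"
  where "\<D> f \<equiv> zlaurent_deriv (zl_of_fps f)"

text \<open>
  The exponents of the successive factors: \<open>t i\<close> is the antiderivative, in terms of the next
  variable, of what remains of the equation after the first \<open>i\<close> factors.
\<close>

fun t :: "nat \<Rightarrow> 'p mod_ring zpoly fps"
  where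
    "t 0 = fps_zconst h\<^sub>0 * fps_const (zvar 0)"
  | "t (Suc i) = (fps_zconst h oo t i) * fps_const (zvar (Suc i))"

text \<open>
  This is \<open>1 / \<partial> z\<close> for the variable \<open>z\<close> with index \<open>i\<close>.
\<close>

definition log_weight :: "nat \<Rightarrow> 'p mod_ring zlaurent"
  where "log_weight i = fls_X * (\<Prod>k<i. zl_var k)"

definition partial_product :: "nat \<Rightarrow> 'p mod_ring zpoly fps"
  where "partial_product i = fps_zconst u * (\<Prod>j<i. fps_zconst e oo t j)"

text \<open>
  The factors from the one with index \<open>n\<close> on are congruent to 1 modulo \<open>x\<^bsup>n+1\<^esup>\<close>, so the coefficient at \<open>n\<close>
  of the infinite product is that of the partial product.
\<close>

definition solution :: "'p mod_ring zpoly fps"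
  where "solution = Abs_fps (\<lambda>n. partial_product n $ n)"

lemma log_weight_nonzero: "log_weight i \<noteq> 0"
proof -
  have "zvar j \<noteq> (0 :: 'p mod_ring zpoly)" for j
    by (metis lookup_single_eq lookup_zero one_neq_zero zvar_def)
  then have "zl_var j \<noteq> (0 :: 'p mod_ring zlaurent)" for j
    by (simp add: zl_var_def)
  then show ?thesis by (simp add: log_weight_def)
qed

text \<open>
  Since \<open>h\<close> has neither constant nor linear term, the order of \<open>t i\<close> in \<open>x\<close> at least doubles in each
  step.
\<close>

lemma t_vanishes: "k \<le> i \<Longrightarrow> t i $ k = 0"
proof (induction i arbitrary: k)
  case 0
  then show ?case using h\<^sub>0(1) by simp
next
  case (Suc i)
  have t0: "t i $ 0 = 0" using Suc.IH[of 0] by simp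
  have h1: "h $ 1 = 0"
    using arg_cong[OF h(2), of "\<lambda>f. f $ 0"] by simp
  define h' h'' where "h' = fps_shift 1 h" and "h'' = fps_shift 1 h'"
  have h': "h = fps_const 0 + fps_X * h'"
    by (rule fps_ext) (simp add: h'_def h(1))
  have h'': "h' = fps_const 0 + fps_X * h''"
    by (rule fps_ext) (use h1 in \<open>simp add: h'_def h''_def\<close>)
  have "fps_zconst h oo t i = fps_const (zconst 0) + t i * (fps_zconst h' oo t i)"
    by (subst h') (rule fps_zconst_compose_split[OF t0])
  also have "fps_zconst h' oo t i = fps_const (zconst 0) + t i * (fps_zconst h'' oo t i)"
    by (subst h'') (rule fps_zconst_compose_split[OF t0])
  finally have "fps_zconst h oo t i = t i * (t i * (fps_zconst h'' oo t i))"
    by simp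
  moreover have "(t i * (t i * g)) $ k = 0" for g
    unfolding fps_mult_nth
  proof (intro sum.neutral ballI)
    fix j assume "j \<in> {0..k}"
    \<comment> \<open>As \<open>k \<le> i + 1\<close>, one of \<open>j\<close> and \<open>k - j\<close> is at most \<open>i\<close>.\<close>
    show "t i $ j * (\<Sum>l=0..k - j. t i $ l * g $ (k - j - l)) = 0"
    proof (cases "j \<le> i")
      case False
      then have "k - j \<le> i" using Suc.prems by simp
      then show ?thesis using Suc.IH by (auto intro!: sum.neutral)
    qed (simp add: Suc.IH)
  qed
  ultimately show ?case by simp
qed

text \<open>
  As \<open>h\<^sub>0\<close> and \<open>h\<close> have derivative 0, so have their compositions with series: only the last variable
  in \<open>t i\<close> contributes to its derivative.
\<close>

lemma deriv_t:
  "\<D> (t 0) * fls_X = zl_of_fps (fps_zconst h\<^sub>0)"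
  "\<D> (t (Suc i)) * log_weight (Suc i) = zl_of_fps (fps_zconst h oo t i)"
  "\<D> (t i) * log_weight (Suc i) = zl_of_fps (t i)"
proof -
  have var: "\<D> (g * fps_const (zvar j)) * log_weight j = zl_of_fps g" if "\<D> g = 0" for g j
    using that log_weight_nonzero[of j]
    by (simp add: zl_of_fps.hom_mult zl_of_fps_zvar zlaurent_deriv_mult zlaurent_deriv_zl_var
        flip: log_weight_def)
  show 0: "\<D> (t 0) * fls_X = zl_of_fps (fps_zconst h\<^sub>0)"
    using var[of "fps_zconst h\<^sub>0" 0] by (simp add: zlaurent_deriv_fps_zconst h\<^sub>0 log_weight_def)
  show Suc: "\<D> (t (Suc i)) * log_weight (Suc i) = zl_of_fps (fps_zconst h oo t i)" for i
    using var[of "fps_zconst h oo t i" "Suc i"]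
    by (simp add: zlaurent_deriv_compose t_vanishes h)
  have log_weight: "log_weight (Suc j) = log_weight j * zl_var j" for j
    by (simp add: log_weight_def mult_ac)
  have "\<D> (t i) * log_weight i * zl_var i = zl_of_fps (t i)"
    using 0 Suc by (cases i) (simp_all add: log_weight_def zl_of_fps.hom_mult zl_of_fps_zvar)
  then show "\<D> (t i) * log_weight (Suc i) = zl_of_fps (t i)"
    by (simp add: log_weight mult.assoc)
qed

text \<open>
  By the choice of the exponents, \<open>\<partial>(t i)\<close> and \<open>\<partial>(t (Suc i))\<close> are obtained from \<open>t i\<close> and \<open>h(t i)\<close> by
  dividing by the same series. So the claim is \<open>\<theta> e = (x - h) e\<close>, with \<open>t i\<close> substituted for \<open>x\<close>, divided
  by this series.
\<close>

lemma deriv_factor: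
  "\<D> (fps_zconst e oo t i) = (\<D> (t i) - \<D> (t (Suc i))) * zl_of_fps (fps_zconst e oo t i)"
proof -
  let ?T = "zl_of_fps (t i)" and ?H = "zl_of_fps (fps_zconst h oo t i)"
    and ?E = "zl_of_fps (fps_zconst e oo t i)" and ?E' = "zl_of_fps (fps_zconst (fps_deriv e) oo t i)"
  have t0: "t i $ 0 = 0" by (simp add: t_vanishes)
  have "fps_X * fps_deriv e = (fps_X - h) * e"
    using e(2) by (simp only: euler_def)
  then have "zl_of_fps (fps_zconst (fps_X * fps_deriv e) oo t i) = zl_of_fps (fps_zconst ((fps_X - h) * e) oo t i)"
    by (simp only:)
  then have E: "?T * ?E' = (?T - ?H) * ?E"
    using t0
    by (simp add: fps_zconst.hom_mult fps_zconst.hom_minus fps_compose_mult_distrib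
        fps_compose_sub_distrib zl_of_fps.hom_mult zl_of_fps.hom_minus)
  have "\<D> (fps_zconst e oo t i) * log_weight (Suc i) = ?E' * (\<D> (t i) * log_weight (Suc i))"
    by (simp add: zlaurent_deriv_compose[OF t0] mult.assoc)
  also have "\<dots> = (\<D> (t i) * log_weight (Suc i) - \<D> (t (Suc i)) * log_weight (Suc i)) * ?E"
    unfolding deriv_t(2,3) using E by (simp only: mult.commute[of ?E'])
  also have "\<dots> = (\<D> (t i) - \<D> (t (Suc i))) * ?E * log_weight (Suc i)"
    by (simp add: algebra_simps)
  finally show ?thesis using log_weight_nonzero by simp
qed

text \<open>
  The logarithmic derivatives of the factors telescope.
\<close>

lemma deriv_partial_product:
  "\<D> (partial_product i) = (zl_of_fps (fps_zconst a) - \<D> (t i)) * zl_of_fps (partial_product i)"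
proof (induction i)
  case 0
  let ?U = "zl_of_fps (fps_zconst u)" and ?A = "zl_of_fps (fps_zconst a)"
  have "fps_X * fps_deriv u = (fps_X * a - h\<^sub>0) * u"
    using u(2) by (simp only: euler_def)
  then have "zl_of_fps (fps_zconst (fps_X * fps_deriv u)) = zl_of_fps (fps_zconst ((fps_X * a - h\<^sub>0) * u))"
    by (simp only:)
  then have "fls_X * \<D> (fps_zconst u) = (fls_X * ?A - \<D> (t 0) * fls_X) * ?U"
    unfolding deriv_t(1)
    by (simp add: fps_zconst.hom_mult fps_zconst.hom_minus zl_of_fps.hom_mult zl_of_fps.hom_minus
        zl_of_fps_X zlaurent_deriv_fps_zconst)
  then have "fls_X * \<D> (fps_zconst u) = fls_X * ((?A - \<D> (t 0)) * ?U)"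
    by (simp add: algebra_simps)
  then show ?case by (simp add: partial_product_def)
next
  case (Suc i)
  have "partial_product (Suc i) = partial_product i * (fps_zconst e oo t i)" by (simp add: partial_product_def mult.assoc)
  then have "\<D> (partial_product (Suc i)) = zl_of_fps (partial_product i) * \<D> (fps_zconst e oo t i) +
      \<D> (partial_product i) * zl_of_fps (fps_zconst e oo t i)"
    by (simp only: zl_of_fps.hom_mult zlaurent_deriv_mult)
  then show ?case
    unfolding Suc deriv_factor \<open>partial_product (Suc i) = _\<close>
    by (simp add: zl_of_fps.hom_mult algebra_simps del: t.simps)
qed

lemma partial_product_stable: "n \<le> i \<Longrightarrow> partial_product i $ n = partial_product n $ n"
proof (induction i rule: dec_induct)
  case (step i)
  define e' where "e' = fps_shift 1 e"
  have e': "e = fps_const 1 + fps_X * e'"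
    by (rule fps_ext) (simp add: e(1) e'_def)
  have "fps_zconst e oo t i = fps_const (zconst 1) + t i * (fps_zconst e' oo t i)"
    by (subst e') (rule fps_zconst_compose_split, simp add: t_vanishes)
  moreover have "partial_product (Suc i) = partial_product i * (fps_zconst e oo t i)"
    by (simp add: partial_product_def mult.assoc)
  ultimately have "partial_product (Suc i) = partial_product i + t i * ((fps_zconst e' oo t i) * partial_product i)"
    by (simp add: algebra_simps)
  moreover have "(t i * g) $ n = 0" for g
    unfolding fps_mult_nth using step(1) by (intro sum.neutral) (simp add: t_vanishes)
  ultimately show ?case using step.IH by simp
qed simp

lemma solution_eq_partial_product: "n \<le> i \<Longrightarrow> solution $ n = partial_product i $ n"
  using partial_product_stable[of n i] by (simp add: solution_def)

lemma solution_nonzero: "solution \<noteq> 0"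
proof -
  have "solution $ 0 = zconst 1" using u(1) by (simp add: solution_def partial_product_def)
  then show ?thesis by auto
qed

lemma deriv_solution: "\<D> solution = zl_of_fps (fps_zconst a) * zl_of_fps solution"
proof -
  let ?A = "zl_of_fps (fps_zconst a)"
  have "vanishes_below (int m - 1) (\<D> solution - ?A * zl_of_fps solution)" for m
  proof -
    let ?R = "zl_of_fps (solution - partial_product m)"
    have R: "vanishes_below (int m) ?R"
      by (intro vanishes_below_zl_of_fps') (simp add: solution_eq_partial_product)
    have T: "vanishes_below (int m) (zl_of_fps (t m))"
      by (intro vanishes_below_zl_of_fps') (simp add: t_vanishes)
    have "\<D> solution - ?A * zl_of_fps solution = zlaurent_deriv ?R - ?A * ?R - \<D> (t m) * zl_of_fps (partial_product m)"
      by (simp add: zl_of_fps.hom_minus zlaurent_deriv_diff deriv_partial_product algebra_simps)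
    moreover have "vanishes_below (int m - 1) (zlaurent_deriv ?R)"
      by (rule vanishes_below_zlaurent_deriv[OF R])
    moreover have "vanishes_below (int m - 1) (?A * ?R)"
      using vanishes_below_mult[OF vanishes_below_zl_of_fps R] by (rule vanishes_below_mono) simp
    moreover have "vanishes_below (int m - 1) (\<D> (t m) * zl_of_fps (partial_product m))"
      using vanishes_below_mult[OF vanishes_below_zlaurent_deriv[OF T] vanishes_below_zl_of_fps] by simp
    ultimately show ?thesis by (simp add: vanishes_below_diff)
  qed
  then have "\<D> solution - ?A * zl_of_fps solution = 0" by (rule vanishes_below_all)
  then show ?thesis by simp
qed

lemma comm_ring_hom_zproj: "comm_ring_hom (zproj i :: 'p mod_ring zpoly fps \<Rightarrow> _)"
  unfolding zproj_def by (rule comm_ring_hom_fps_map[OF comm_ring_hom_zsubst])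

lemma zproj_fps_zconst: "zproj i (fps_zconst f) = fps_zconst (f :: 'p mod_ring fps)"
  by (rule fps_ext) (simp add: zproj_def zsubst_zconst)

lemma zproj_compose: "zproj i (fps_zconst f oo s) = fps_zconst f oo zproj i (s :: 'p mod_ring zpoly fps)"
  unfolding zproj_def fps_map_fps_compose[OF comm_ring_hom_zsubst]
  by (simp only: zproj_fps_zconst[unfolded zproj_def])

lemma zproj_zvar:
  "zproj i (fps_const (zvar j) :: 'p mod_ring zpoly fps) = (if j < i then fps_const (zvar j) else 0)"
proof (rule fps_ext)
  fix n
  have "zsubst s 0 = (0 :: 'p mod_ring zpoly)" for s by (simp add: zsubst_def)
  then show "zproj i (fps_const (zvar j)) $ n =
      (if j < i then fps_const (zvar j) else 0 :: 'p mod_ring zpoly fps) $ n"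
    by (cases n) (simp_all add: zproj_def zsubst_zvar)
qed

lemma zproj_t: "zproj i (t j) = (if j < i then t j else 0)"
proof -
  interpret P: comm_ring_hom "zproj i :: 'p mod_ring zpoly fps \<Rightarrow> _" by (rule comm_ring_hom_zproj)
  show ?thesis
  proof (induction j)
    case 0
    show ?case by (simp add: P.hom_mult zproj_zvar zproj_fps_zconst)
  next
    case (Suc j)
    show ?case by (simp add: P.hom_mult zproj_zvar zproj_compose Suc)
  qed
qed

text \<open>
  All factors from the one with index \<open>i\<close> on become \<open>e(0) = 1\<close>.
\<close>

lemma zproj_solution: "zproj i solution = partial_product i"
proof (rule fps_ext)
  fix n
  interpret P: comm_ring_hom "zproj i :: 'p mod_ring zpoly fps \<Rightarrow> _" by (rule comm_ring_hom_zproj)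
  define m where "m = max n i"
  have "zproj i (partial_product m) = fps_zconst u * (\<Prod>j<m. fps_zconst e oo (if j < i then t j else 0))"
    by (simp add: partial_product_def P.hom_mult P.hom_prod zproj_fps_zconst zproj_compose zproj_t)
  also have "(\<Prod>j<m. fps_zconst e oo (if j < i then t j else 0)) = (\<Prod>j<i. fps_zconst e oo t j)"
    by (rule prod.mono_neutral_cong_right) (auto simp: m_def e(1))
  finally have "zproj i (partial_product m) = partial_product i" by (simp add: partial_product_def)
  moreover have "zproj i solution $ n = zproj i (partial_product m) $ n"
    using solution_eq_partial_product[of n m] by (simp add: zproj_def m_def)
  ultimately show "zproj i solution $ n = partial_product i $ n" by simp
qed

lemma algebraic_over_t:
  assumes "algebraic_fps h\<^sub>0" "algebraic_fps h" "j < i"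
  shows "algebraic_over (field_gen (insert fls_X (zl_var ` {..<i}))) (zl_of_fps (t j))"
proof -
  let ?K = "field_gen (insert fls_X (zl_var ` {..<i})) :: 'p mod_ring zlaurent set"
  have var: "algebraic_over ?K (zl_of_fps (fps_const (zvar j)))" if "j < i" for j
    using that by (simp add: zl_of_fps_zvar algebraic_over_self field_gen.incl)
  show ?thesis
    using assms(3)
  proof (induction j)
    case 0
    have "algebraic_over ?K (zl_of_fps (fps_zconst h\<^sub>0 oo fps_X))"
      using assms(1) by (intro algebraic_over_compose)
        (simp_all add: zl_of_fps_X algebraic_over_self field_gen.incl)
    then show ?case
      using 0 by (simp add: zl_of_fps.hom_mult algebraic_over_field_ops var)
  next
    case (Suc j)
    have "algebraic_over ?K (zl_of_fps (fps_zconst h oo t j))"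
      using assms(2) Suc by (intro algebraic_over_compose) (simp_all add: t_vanishes)
    then show ?case
      using Suc.prems by (simp add: zl_of_fps.hom_mult algebraic_over_field_ops var)
  qed
qed

lemma algebraic_over_partial_product:
  assumes "algebraic_fps h\<^sub>0" "algebraic_fps u" "algebraic_fps h" "algebraic_fps e"
  shows "algebraic_over (field_gen (insert fls_X (zl_var ` {..<i}))) (zl_of_fps (partial_product i))"
proof -
  let ?K = "field_gen (insert fls_X (zl_var ` {..<i})) :: 'p mod_ring zlaurent set"
  have U: "algebraic_over ?K (zl_of_fps (fps_zconst u oo fps_X))"
    using assms(2) by (intro algebraic_over_compose)
      (simp_all add: zl_of_fps_X algebraic_over_self field_gen.incl)
  have E: "algebraic_over ?K (zl_of_fps (fps_zconst e oo t j))" if "j < i" for j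
    using assms that by (intro algebraic_over_compose algebraic_over_t) (simp_all add: t_vanishes)
  have "algebraic_over ?K (zl_of_fps (fps_zconst u * (\<Prod>j<m. fps_zconst e oo t j)))" if "m \<le> i" for m
    using that
  proof (induction m)
    case 0
    then show ?case using U by simp
  next
    case (Suc m)
    then show ?case
      using E[of m] by (simp add: zl_of_fps.hom_mult algebraic_over_field_ops mult.assoc[symmetric])
  qed
  then show ?thesis by (simp add: partial_product_def)
qed

end

theorem theorem1p2:
  fixes a :: "'p::prime_card mod_ring fls"
  assumes "algebraic_over (field_gen {fls_X}) a"
    and "regular_at_0 a"
    and "local_exponent a = 0"
  shows "\<exists>y :: 'p mod_ring zpoly fps. y \<noteq> 0 \<and>
           zlaurent_deriv (zl_of_fps y) = zl_of_fls a * zl_of_fps y \<and>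
           (\<forall>i\<ge>1. algebraic_over (field_gen (insert fls_X (zl_var ` {..<i})))
                     (zl_of_fps (zproj i y)))"
proof -
  define a' where "a' = fls_regpart a"
  have "a $$ n = 0" if "n < 0" for n
  proof (cases "n = -1")
    case True
    then show ?thesis using assms(3) by (simp add: local_exponent_def fls_residue_def)
  next
    case False
    then show ?thesis using that assms(2) by (simp add: regular_at_0_def)
  qed
  then have a: "a = fps_to_fls a'"
    by (intro fls_eqI) (simp add: a'_def)
  then have alg: "algebraic_fps a'" using assms(1) by (simp add: algebraic_fps_def)
  obtain h\<^sub>0 u where hu: "h\<^sub>0 $ 0 = 0" "fps_deriv h\<^sub>0 = 0" "u $ 0 = 1"
    "euler u = (fps_X * a' - h\<^sub>0) * u" "algebraic_fps h\<^sub>0" "algebraic_fps u"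
    using algebraic_solution_modulo_constants[of "fps_X * a'"] alg
    by (auto simp: algebraic_fps_mult algebraic_fps_X)
  obtain h e where he: "h $ 0 = 0" "fps_deriv h = 0" "e $ 0 = 1"
    "euler e = (fps_X - h) * e" "algebraic_fps h" "algebraic_fps (e :: 'p mod_ring fps)"
    using algebraic_solution_modulo_constants[of fps_X] by (auto simp: algebraic_fps_X)
  interpret iterated_log_tower a' h\<^sub>0 u h e
    by unfold_locales (fact hu he)+
  show ?thesis
    using solution_nonzero deriv_solution algebraic_over_partial_product[OF hu(5,6) he(5,6)]
    by (intro exI[of _ solution]) (simp add: a zl_of_fls_fps zproj_solution)
qed

end
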